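(* Let $K=\mathbb{F}_q$ be a finite field, let $v_1,\ldots,v_n$ be positive integers, and let $X\subset\mathbb{P}^{n-1}$ be the degenerate projective torus parameterized by $x_1^{v_1},\ldots,x_n^{v_n}$, with vanishing ideal $I(X)\subset S=K[t_1,\ldots,t_n]$. Let $\beta$ be a generator of the cyclic group $K^*$, let $d_i=o(\beta^{v_i})$ be the order of $\beta^{v_i}$ in $K^*$, let $r=\gcd(d_1,\ldots,d_n)$, let $d_i'=o(\beta^{rv_i})$, and let $\mathcal{S}'=\mathbb{N}d_1'+\cdots+\mathbb{N}d_n'$, which is a numerical semigroup, with Frobenius number $g(\mathcal{S}')$. Then: (i) $\deg(S/I(X))=d_1\cdots d_n/\gcd(d_1,\ldots,d_n)$. (ii) If $I(X)$ is a complete intersection, then $$\mathrm{reg}\, S/I(X)=\gcd(d_1,\ldots,d_n)\, g(\mathcal{S}')+\sum_{i=1}^n d_i-(n-1).$$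
   Context: $X=\{[(x_1^{v_1},\ldots,x_n^{v_n})] : x_i\in K^*\text{ for all }i\}\subset\mathbb{P}^{n-1}$, where $\mathbb{P}^{n-1}$ is the projective space over $K$ and $K^*=K\setminus\{0\}$. $S=K[t_1,\ldots,t_n]=\oplus_{d\ge 0}S_d$ has the standard grading, and $I(X)$ is the ideal of $S$ generated by the homogeneous polynomials that vanish at all points of $X$. The Hilbert function of $S/I(X)$ is $H_X(d)=\dim_K(S_d/(I(X)\cap S_d))$. The Hilbert polynomial $h_X(t)=\sum_{i=0}^{k-1}c_it^i\in\mathbb{Q}[t]$, of degree $k-1=\dim(S/I(X))-1$, is the unique polynomial with $h_X(d)=H_X(d)$ for $d\gg 0$. The degree is $\deg(S/I(X))=c_{k-1}(k-1)!$. (Here $\dim(S/I(X))=1$, so $h_X$ is the constant $c_0=\deg(S/I(X))$.) The index of regularity $\mathrm{reg}(S/I(X))$ is the least integer $\ell\ge 0$ such that $h_X(d)=H_X(d)$ for all $d\ge\ell$. An ideal $I\subset S$ is a complete intersection if $I=(f_1,\ldots,f_m)$ for some $f_1,\ldots,f_m\in S$ with $m=\mathrm{ht}(I)$; $I(X)$ has height $n-1$. A semigroup $\mathbb{N}a_1+\cdots+\mathbb{N}a_n$ (with $0\in\mathbb{N}$ and the $a_i$ positive integers) is a numerical semigroup if $\gcd(a_1,\ldots,a_n)=1$. Its Frobenius number is the largest integer not belonging to it (so it is $-1$ if the semigroup is $\mathbb{N}$). *)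

theory Defs
  imports
    "HOL-Library.Poly_Mapping"
    "HOL-Library.Extended_Nat"
    "HOL-Library.Cardinality"
    "HOL-Computational_Algebra.Polynomial"
    "HOL-Algebra.QuotRing"
    "HOL-Algebra.Multiplicative_Group"
    "Jordan_Normal_Form.VS_Connect"
begin

definition prime_chain :: "('a, 'b) ring_scheme \<Rightarrow> (nat \<Rightarrow> 'a set) \<Rightarrow> nat \<Rightarrow> bool" where
  "prime_chain R P l \<longleftrightarrow> (\<forall>i\<le>l. primeideal (P i) R) \<and> (\<forall>i<l. P i \<subset> P (Suc i))"

text \<open>As a supremum in \<^typ>\<open>enat\<close>, the dimension of the zero ring comes out as \<open>0\<close>.\<close>
definition krull_dim :: "('a, 'b) ring_scheme \<Rightarrow> enat" where
  "krull_dim R = Sup {enat l | l P. prime_chain R P l}"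

definition prime_height :: "('a, 'b) ring_scheme \<Rightarrow> 'a set \<Rightarrow> enat" where
  "prime_height R Q = Sup {enat l | l P. prime_chain R P l \<and> P l = Q}"

definition height :: "('a, 'b) ring_scheme \<Rightarrow> 'a set \<Rightarrow> enat" where
  "height R I = Inf {prime_height R Q | Q. primeideal Q R \<and> I \<subseteq> Q}"

definition complete_intersection :: "('a, 'b) ring_scheme \<Rightarrow> 'a set \<Rightarrow> bool" where
  "complete_intersection R I \<longleftrightarrow>
     (\<exists>fs. set fs \<subseteq> carrier R \<and> I = Idl\<^bsub>R\<^esub> (set fs) \<and> enat (length fs) = height R I)"

text \<open>The fields \<open>mult\<close> and \<open>one\<close> are part of the record type of modules but play no role in
  the module structure.\<close>
definition quot_module :: "('a, 'b, 'c) module_scheme \<Rightarrow> 'b set \<Rightarrow> ('a, 'b set) module" where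
  "quot_module M W =
     \<lparr>carrier = a_rcosets\<^bsub>M\<^esub> W, mult = rcoset_mult M W, one = W +>\<^bsub>M\<^esub> \<one>\<^bsub>M\<^esub>,
      zero = W, add = set_add M,
      smult = (\<lambda>c A. \<Union>x\<in>A. W +>\<^bsub>M\<^esub> (c \<odot>\<^bsub>M\<^esub> x))\<rparr>"

text \<open>The variables are indexed by a finite type \<open>'n\<close>, so that \<open>n\<close> is \<open>CARD('n)\<close>;
  a monomial is its exponent vector.\<close>
type_synonym ('n, 'a) mpoly = "('n \<Rightarrow>\<^sub>0 nat) \<Rightarrow>\<^sub>0 'a"

text \<open>One record serves both as the ring \<open>S = K[t\<^sub>1,\<dots>,t\<^sub>n]\<close> and as the \<open>K\<close>-vector space underlying it.\<close>
definition poly_alg :: "('a :: field, ('n :: finite, 'a) mpoly) module" where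
  "poly_alg =
     \<lparr>carrier = UNIV, mult = (*), one = 1, zero = 0, add = (+),
      smult = (\<lambda>c p. Poly_Mapping.single 0 c * p)\<rparr>"

definition eval_mpoly :: "('n :: finite, 'a :: field) mpoly \<Rightarrow> ('n \<Rightarrow> 'a) \<Rightarrow> 'a" where
  "eval_mpoly p x =
     (\<Sum>m\<in>Poly_Mapping.keys p. Poly_Mapping.lookup p m * (\<Prod>i\<in>UNIV. x i ^ Poly_Mapping.lookup m i))"

definition homog_part :: "nat \<Rightarrow> ('n :: finite, 'a :: field) mpoly set" where
  "homog_part d = {p. \<forall>m\<in>Poly_Mapping.keys p. (\<Sum>i\<in>UNIV. Poly_Mapping.lookup m i) = d}"

abbreviation homogeneous :: "('n :: finite, 'a :: field) mpoly \<Rightarrow> bool" where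
  "homogeneous p \<equiv> \<exists>d. p \<in> homog_part d"

definition hilbert_fun :: "('n :: finite, 'a :: field) mpoly set \<Rightarrow> nat \<Rightarrow> nat" where
  "hilbert_fun I d =
     vectorspace.dim class_ring
       (quot_module (poly_alg\<lparr>carrier := homog_part d\<rparr>) (I \<inter> homog_part d))"

definition hilbert_poly :: "('n :: finite, 'a :: field) mpoly set \<Rightarrow> rat poly" where
  "hilbert_poly I =
     (THE h. eventually (\<lambda>d. poly h (of_nat d) = of_nat (hilbert_fun I d)) sequentially)"

definition deg_quot :: "('n :: finite, 'a :: field) mpoly set \<Rightarrow> rat" where
  "deg_quot I =
     (let k = the_enat (krull_dim (poly_alg Quot I))
      in coeff (hilbert_poly I) (k - 1) * fact (k - 1))"

definition reg_quot :: "('n :: finite, 'a :: field) mpoly set \<Rightarrow> nat" where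
  "reg_quot I =
     (LEAST l. \<forall>d\<ge>l. poly (hilbert_poly I) (of_nat d) = of_nat (hilbert_fun I d))"

definition proj_rel :: "(('n \<Rightarrow> 'a :: field) \<times> ('n \<Rightarrow> 'a)) set" where
  "proj_rel = {(x, y). x \<noteq> (\<lambda>_. 0) \<and> y \<noteq> (\<lambda>_. 0) \<and> (\<exists>c. c \<noteq> 0 \<and> y = (\<lambda>i. c * x i))}"

definition proj_space :: "('n \<Rightarrow> 'a :: field) set set" where
  "proj_space = {x. x \<noteq> (\<lambda>_. 0)} // proj_rel"

definition proj_point :: "('n \<Rightarrow> 'a :: field) \<Rightarrow> ('n \<Rightarrow> 'a) set" where
  "proj_point x = proj_rel `` {x}"

definition degenerate_torus :: "('n \<Rightarrow> nat) \<Rightarrow> ('n \<Rightarrow> 'a :: field) set set" where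
  "degenerate_torus v = {proj_point (\<lambda>i. x i ^ v i) | x. \<forall>i. x i \<noteq> 0}"

definition vanishing_ideal :: "('n :: finite \<Rightarrow> 'a :: field) set set \<Rightarrow> ('n, 'a) mpoly set" where
  "vanishing_ideal X =
     Idl\<^bsub>poly_alg\<^esub> {f. homogeneous f \<and> (\<forall>P\<in>X. \<forall>x\<in>P. eval_mpoly f x = 0)}"

lemma degenerate_torus_subset_proj_space:
  "degenerate_torus v \<subseteq> (proj_space :: ('n \<Rightarrow> 'a :: field) set set)"
proof -
  have "(\<lambda>i. x i ^ v i) \<noteq> (\<lambda>_. 0)" if "\<forall>i. x i \<noteq> 0" for x :: "'n \<Rightarrow> 'a"
    using that by (auto simp: fun_eq_iff)
  then show ?thesis
    by (auto simp: degenerate_torus_def proj_space_def proj_point_def intro!: quotientI)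
qed

definition semigroup_gen :: "('n :: finite \<Rightarrow> nat) \<Rightarrow> nat set" where
  "semigroup_gen a = {\<Sum>i\<in>UNIV. c i * a i | c. True}"

text \<open>Taken over the integers, hence \<open>-1\<close> for the semigroup of all natural numbers.\<close>
definition frobenius_number :: "nat set \<Rightarrow> int" where
  "frobenius_number A = (GREATEST z. z \<notin> int ` A)"

end

theory Submission
  imports Defs "Jordan_Normal_Form.Char_Poly"
begin

text \<open>
  Put \<open>\<gamma>\<^sub>i = \<beta>^(v\<^sub>i)\<close>, an element of order \<open>d\<^sub>i\<close>. Up to scaling, the points of \<open>X\<close> are the tuples of powers of the
  \<open>\<gamma>\<^sub>i\<close>, so by orthogonality of characters a form vanishes on \<open>X\<close> iff its coefficients sum to \<open>0\<close> over
  each class of exponent vectors modulo \<open>(d\<^sub>1,\<dots>,d\<^sub>n)\<close>. Hence \<open>H\<^sub>X(D)\<close> is the number of \<open>e\<close> with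
  \<open>0 \<le> e\<^sub>i < d\<^sub>i\<close> such that \<open>D - |e|\<close> lies in \<open>\<nat>d\<^sub>1 + \<dots> + \<nat>d\<^sub>n = r S'\<close>. Exactly \<open>d\<^sub>1\<dots>d\<^sub>n / r\<close> of these \<open>e\<close>
  satisfy \<open>|e| = D (mod r)\<close>, and all of them count as soon as \<open>D > r g(S') + \<Sum>(d\<^sub>i - 1)\<close>, whereas for
  \<open>D\<close> equal to that bound the corner \<open>e\<^sub>i = d\<^sub>i - 1\<close> is missing.

  The dimension of \<open>S/I(X)\<close> is at most \<open>1\<close> because \<open>I(X)\<close> contains the products \<open>\<Prod>\<^sub>c (t\<^sub>i - c t\<^sub>j)\<close> over
  \<open>c \<in> K\<^sup>*\<close>: a prime over \<open>I(X)\<close> contains a factor of each, and thus the ideal of a line through the origin.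
\<close>

section \<open>Polynomials in finitely many variables\<close>

lemma mpoly_sum_monomials:
  "(\<Sum>m\<in>Poly_Mapping.keys p. Poly_Mapping.single m (Poly_Mapping.lookup p m)) = p"
proof (rule poly_mapping_eqI)
  fix k
  have "Poly_Mapping.lookup (\<Sum>m\<in>Poly_Mapping.keys p. Poly_Mapping.single m (Poly_Mapping.lookup p m)) k
      = (\<Sum>m\<in>Poly_Mapping.keys p. if m = k then Poly_Mapping.lookup p m else 0)"
    by (simp add: lookup_sum lookup_single when_def)
  also have "\<dots> = Poly_Mapping.lookup p k"
    by (simp add: sum.delta in_keys_iff)
  finally show "Poly_Mapping.lookup (\<Sum>m\<in>Poly_Mapping.keys p. Poly_Mapping.single m (Poly_Mapping.lookup p m)) k
    = Poly_Mapping.lookup p k" .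
qed

lemma mpoly_induct [case_names single add]:
  fixes P :: "('k \<Rightarrow>\<^sub>0 'b :: comm_monoid_add) \<Rightarrow> bool"
  assumes "\<And>m c. P (Poly_Mapping.single m c)" and "\<And>p q. P p \<Longrightarrow> P q \<Longrightarrow> P (p + q)"
  shows "P p"
proof -
  have "P (\<Sum>m\<in>A. Poly_Mapping.single m (Poly_Mapping.lookup p m))" if "finite A" for A
    using that
  proof (induction A rule: finite_induct)
    case empty
    \<comment> \<open>\<open>P 0\<close> is the monomial case with coefficient 0.\<close>
    then show ?case using assms(1)[of undefined 0] by simp
  qed (auto intro: assms)
  from this[of "Poly_Mapping.keys p"] show ?thesis by (simp add: mpoly_sum_monomials)
qed

lemma sum_keys_mono_neutral:
  fixes p :: "'k \<Rightarrow>\<^sub>0 'a :: comm_semiring_1"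
  assumes "finite A" "Poly_Mapping.keys p \<subseteq> A"
  shows "(\<Sum>m\<in>Poly_Mapping.keys p. Poly_Mapping.lookup p m * f m) = (\<Sum>m\<in>A. Poly_Mapping.lookup p m * f m)"
  using assms by (intro sum.mono_neutral_left) (auto simp: in_keys_iff)

text \<open>Cancellation may shrink the keys of \<open>p + q\<close>, so all three sums are extended
  to the union of the keys of \<open>p\<close> and \<open>q\<close>, where the extra terms are 0.
  Evaluation and class sums both get their additivity from here.\<close>

lemma sum_keys_add:
  fixes p q :: "'k \<Rightarrow>\<^sub>0 'a :: comm_semiring_1"
  shows "(\<Sum>m\<in>Poly_Mapping.keys (p + q). Poly_Mapping.lookup (p + q) m * f m) =
    (\<Sum>m\<in>Poly_Mapping.keys p. Poly_Mapping.lookup p m * f m)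
    + (\<Sum>m\<in>Poly_Mapping.keys q. Poly_Mapping.lookup q m * f m)"
proof -
  let ?A = "Poly_Mapping.keys p \<union> Poly_Mapping.keys q"
  have "Poly_Mapping.keys (p + q) \<subseteq> ?A" by (rule keys_add)
  then show ?thesis
    using sum_keys_mono_neutral[of ?A "p + q" f] sum_keys_mono_neutral[of ?A p f]
      sum_keys_mono_neutral[of ?A q f]
    by (simp add: lookup_add distrib_right sum.distrib)
qed

lemma sum_keys_single:
  fixes c :: "'a :: comm_semiring_1"
  shows "(\<Sum>m\<in>Poly_Mapping.keys (Poly_Mapping.single k c). Poly_Mapping.lookup (Poly_Mapping.single k c) m * f m) = c * f k"
  by (cases "c = 0") auto

lemma eval_mpoly_add: "eval_mpoly (p + q) x = eval_mpoly p x + eval_mpoly q x"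
  unfolding eval_mpoly_def by (rule sum_keys_add)

lemma eval_mpoly_single:
  "eval_mpoly (Poly_Mapping.single m c) x = c * (\<Prod>i\<in>UNIV. x i ^ Poly_Mapping.lookup m i)"
  unfolding eval_mpoly_def by (rule sum_keys_single)

lemma eval_mpoly_zero [simp]: "eval_mpoly 0 x = 0"
  by (simp add: eval_mpoly_def)

lemma eval_mpoly_uminus: "eval_mpoly (- p) x = - eval_mpoly p x"
  using eval_mpoly_add[of p "- p" x] by (simp add: eq_neg_iff_add_eq_0 add.commute)

lemma eval_mpoly_mult: "eval_mpoly (p * q) x = eval_mpoly p x * eval_mpoly q x"
proof (induction p rule: mpoly_induct)
  case (single m c)
  show ?case
  proof (induction q rule: mpoly_induct)
    case (single m' c')
    show ?case
      by (simp add: mult_single eval_mpoly_single lookup_add power_add prod.distrib mult_ac)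
  qed (simp add: distrib_left eval_mpoly_add)
qed (simp add: distrib_right eval_mpoly_add)

lemma eval_mpoly_one [simp]: "eval_mpoly 1 x = 1"
  using eval_mpoly_single[of 0 1 x] by simp

lemma eval_mpoly_prod: "eval_mpoly (\<Prod>j\<in>A. f j) x = (\<Prod>j\<in>A. eval_mpoly (f j) x)"
  by (induction A rule: infinite_finite_induct) (simp_all add: eval_mpoly_mult)

section \<open>Total degree and homogeneous components\<close>

definition mdeg :: "('n :: finite \<Rightarrow>\<^sub>0 nat) \<Rightarrow> nat" where
  "mdeg m = (\<Sum>i\<in>UNIV. Poly_Mapping.lookup m i)"

lemma homog_part_iff: "p \<in> homog_part D \<longleftrightarrow> (\<forall>m\<in>Poly_Mapping.keys p. mdeg m = D)"
  by (simp add: homog_part_def mdeg_def)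

lemma mdeg_add: "mdeg (m + m') = mdeg m + mdeg m'"
  by (simp add: mdeg_def lookup_add sum.distrib)

lemma homog_part_zero [simp]: "0 \<in> homog_part D"
  by (simp add: homog_part_iff)

lemma homog_part_single: "mdeg m = D \<Longrightarrow> Poly_Mapping.single m c \<in> homog_part D"
  by (simp add: homog_part_iff)

lemma homog_part_add: "p \<in> homog_part D \<Longrightarrow> q \<in> homog_part D \<Longrightarrow> p + q \<in> homog_part D"
  using keys_add[of p q] by (auto simp: homog_part_iff)

lemma homog_part_mult: "p \<in> homog_part D \<Longrightarrow> q \<in> homog_part E \<Longrightarrow> p * q \<in> homog_part (D + E)"
  using keys_mult[of p q] by (fastforce simp: homog_part_iff mdeg_add)

lemma homog_part_uminus: "p \<in> homog_part D \<Longrightarrow> - p \<in> homog_part D"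
  by (simp add: homog_part_iff in_keys_iff)

lemma homog_part_one: "1 \<in> homog_part 0"
  by (simp add: homog_part_iff mdeg_def)

lemma homog_part_scale: "p \<in> homog_part D \<Longrightarrow> Poly_Mapping.single 0 c * p \<in> homog_part D"
  using homog_part_mult[OF homog_part_single[of 0 0 c], of p D] by (simp add: mdeg_def)

lemma homog_part_sum: "(\<And>j. j \<in> A \<Longrightarrow> f j \<in> homog_part D) \<Longrightarrow> sum f A \<in> homog_part D"
  by (induction A rule: infinite_finite_induct) (simp_all add: homog_part_add)

lemma homog_part_prod:
  "(\<And>j. j \<in> A \<Longrightarrow> f j \<in> homog_part (e j)) \<Longrightarrow> prod f A \<in> homog_part (sum e A)"
  by (induction A rule: infinite_finite_induct) (simp_all add: homog_part_mult homog_part_one)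

lemma eval_mpoly_homog_scale:
  assumes "p \<in> homog_part D"
  shows "eval_mpoly p (\<lambda>i. c * x i) = c ^ D * eval_mpoly p x"
proof -
  have "(\<Prod>i\<in>UNIV. (c * x i) ^ Poly_Mapping.lookup m i)
      = c ^ D * (\<Prod>i\<in>UNIV. x i ^ Poly_Mapping.lookup m i)" if "m \<in> Poly_Mapping.keys p" for m
    using that assms by (auto simp: homog_part_def power_mult_distrib prod.distrib power_sum)
  then show ?thesis
    by (simp add: eval_mpoly_def sum_distrib_left mult.left_commute)
qed

interpretation poly_alg: cring poly_alg
  by (unfold_locales) (auto simp: poly_alg_def algebra_simps Units_def intro: exI[of _ "- _"])

lemma poly_alg_simps [simp]:
  "carrier poly_alg = UNIV" "(\<otimes>\<^bsub>poly_alg\<^esub>) = (*)" "(\<oplus>\<^bsub>poly_alg\<^esub>) = (+)"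
  "\<one>\<^bsub>poly_alg\<^esub> = 1" "\<zero>\<^bsub>poly_alg\<^esub> = 0"
  by (simp_all add: poly_alg_def)

section \<open>Polynomial functions on a grid of roots of unity\<close>

text \<open>The first three assumptions say that \<open>\<gamma> i\<close> has multiplicative order
  \<open>d i\<close>; the last one permits division by \<open>d i\<close> in the field, as the
  orthogonality argument requires.\<close>

locale exponent_grid =
  fixes \<gamma> :: "'n :: finite \<Rightarrow> 'a :: field" and d :: "'n \<Rightarrow> nat"
  assumes d_pos: "0 < d i"
    and \<gamma>_pow_d: "\<gamma> i ^ d i = 1"
    and \<gamma>_pow_neq: "0 < k \<Longrightarrow> k < d i \<Longrightarrow> \<gamma> i ^ k \<noteq> 1"
    and of_nat_d: "of_nat (d i) \<noteq> (0 :: 'a)"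
begin

lemma \<gamma>_pow_eq_1_iff: "\<gamma> i ^ k = 1 \<longleftrightarrow> d i dvd k"
proof -
  have "\<gamma> i ^ k = (\<gamma> i ^ d i) ^ (k div d i) * \<gamma> i ^ (k mod d i)"
    by (simp flip: power_mult power_add)
  then have "\<gamma> i ^ k = \<gamma> i ^ (k mod d i)" by (simp add: \<gamma>_pow_d)
  then show ?thesis
    using \<gamma>_pow_neq[of "k mod d i" i] d_pos[of i] by (auto simp: dvd_eq_mod_eq_0)
qed

text \<open>A geometric sum whose ratio \<open>\<gamma> i ^ l\<close> is a \<open>d i\<close>-th
  root of unity: it vanishes unless the ratio is 1.\<close>

lemma \<gamma>_power_sum:
  "(\<Sum>k<d i. (\<gamma> i ^ k) ^ l) = (if d i dvd l then of_nat (d i) else 0)"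
proof (cases "d i dvd l")
  case True
  then have "(\<gamma> i ^ k) ^ l = 1" for k
    by (simp add: \<gamma>_pow_eq_1_iff flip: power_mult)
  then show ?thesis using True by simp
next
  case False
  then have neq: "\<gamma> i ^ l \<noteq> 1" by (simp add: \<gamma>_pow_eq_1_iff)
  have "(\<gamma> i ^ l) ^ d i = 1"
    by (simp add: \<gamma>_pow_eq_1_iff flip: power_mult)
  moreover have "(\<Sum>k<d i. (\<gamma> i ^ k) ^ l) = (\<Sum>k<d i. (\<gamma> i ^ l) ^ k)"
    by (simp add: power_mult [symmetric] mult.commute)
  ultimately show ?thesis using False neq by (simp add: geometric_sum)
qed

section \<open>Residue classes of exponent vectors and their coefficient sums\<close>

definition residue :: "('n \<Rightarrow>\<^sub>0 nat) \<Rightarrow> 'n \<Rightarrow> nat" where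
  "residue m = (\<lambda>i. Poly_Mapping.lookup m i mod d i)"

text \<open>The class condition enters as a 0/1 factor, not as a restricted index set, so that
  \<open>sum_keys_add\<close> and \<open>sum_keys_single\<close> apply.\<close>

definition class_sum :: "('n, 'a) mpoly \<Rightarrow> ('n \<Rightarrow> nat) \<Rightarrow> 'a" where
  "class_sum p e = (\<Sum>m\<in>Poly_Mapping.keys p. Poly_Mapping.lookup p m * (if residue m = e then 1 else 0))"

lemma class_sum_add: "class_sum (p + q) e = class_sum p e + class_sum q e"
  unfolding class_sum_def by (rule sum_keys_add)

lemma class_sum_single: "class_sum (Poly_Mapping.single m c) e = (if residue m = e then c else 0)"
  unfolding class_sum_def by (subst sum_keys_single) simp

lemma class_sum_uminus: "class_sum (- p) e = - class_sum p e"
  using class_sum_add[of p "- p"] by (simp add: eq_neg_iff_add_eq_0 add.commute class_sum_def)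

lemma class_sum_sum: "class_sum (sum f A) e = (\<Sum>j\<in>A. class_sum (f j) e)"
  by (induction A rule: infinite_finite_induct) (simp_all add: class_sum_add, simp_all add: class_sum_def)

definition grid_point :: "('n \<Rightarrow> nat) \<Rightarrow> 'n \<Rightarrow> 'a" where
  "grid_point k = (\<lambda>i. \<gamma> i ^ k i)"

abbreviation "grid_indices \<equiv> PiE UNIV (\<lambda>i. {..<d i})"

lemma monomial_grid_point_residue:
  "(\<Prod>i\<in>UNIV. grid_point k i ^ Poly_Mapping.lookup m i) = (\<Prod>i\<in>UNIV. grid_point k i ^ residue m i)"
proof (rule prod.cong)
  fix i
  have "grid_point k i ^ d i = 1"
    by (simp add: grid_point_def \<gamma>_pow_eq_1_iff flip: power_mult)
  moreover have "grid_point k i ^ Poly_Mapping.lookup m i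
      = (grid_point k i ^ d i) ^ (Poly_Mapping.lookup m i div d i) * grid_point k i ^ residue m i"
    by (simp add: residue_def flip: power_mult power_add)
  ultimately show "grid_point k i ^ Poly_Mapping.lookup m i = grid_point k i ^ residue m i"
    by simp
qed simp

text \<open>Fourier inversion on a product of cyclic groups; the exponents \<open>d i - e i\<close>
  represent the inverse character. For a monomial the sum over the grid factors into one power sum
  per coordinate, each \<open>d i\<close> or 0 by \<open>\<gamma>_power_sum\<close>; the general
  case follows by additivity.\<close>

lemma grid_orthogonality:
  assumes e: "\<And>i. e i < d i"
  shows "(\<Sum>k\<in>grid_indices. eval_mpoly p (grid_point k) * (\<Prod>i\<in>UNIV. grid_point k i ^ (d i - e i)))
    = class_sum p e * (\<Prod>i\<in>UNIV. of_nat (d i))"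
proof (induction p rule: mpoly_induct)
  case (single m c)
  let ?l = "\<lambda>i. Poly_Mapping.lookup m i + (d i - e i)"
  have dvd: "d i dvd ?l i \<longleftrightarrow> residue m i = e i" for i
  proof -
    \<comment> \<open>Over the integers the truncated subtraction disappears, and the summand
      \<open>d i\<close> does not affect divisibility by \<open>d i\<close>.\<close>
    have "int (?l i) = int (Poly_Mapping.lookup m i) - int (e i) + int (d i)"
      using e[of i] by simp
    then have "d i dvd ?l i \<longleftrightarrow> int (d i) dvd int (Poly_Mapping.lookup m i) - int (e i)"
      by (metis dvd_add_left_iff dvd_refl int_dvd_int_iff)
    also have "\<dots> \<longleftrightarrow> residue m i = e i"
      using e[of i] by (simp add: residue_def flip: mod_eq_dvd_iff zmod_int)
    finally show ?thesis .
  qed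
  have "(\<Sum>k\<in>grid_indices. eval_mpoly (Poly_Mapping.single m c) (grid_point k)
          * (\<Prod>i\<in>UNIV. grid_point k i ^ (d i - e i)))
      = c * (\<Sum>k\<in>grid_indices. \<Prod>i\<in>UNIV. (\<gamma> i ^ k i) ^ ?l i)"
    by (simp add: eval_mpoly_single grid_point_def sum_distrib_left power_add prod.distrib mult.assoc)
  also have "\<dots> = c * (\<Prod>i\<in>UNIV. \<Sum>k<d i. (\<gamma> i ^ k) ^ ?l i)"
    by (subst prod_sum_PiE) auto
  also have "(\<Prod>i\<in>UNIV. \<Sum>k<d i. (\<gamma> i ^ k) ^ ?l i) = (\<Prod>i\<in>UNIV. if residue m i = e i then of_nat (d i) else 0)"
    by (simp only: \<gamma>_power_sum dvd)
  also have "\<dots> = (if residue m = e then (\<Prod>i\<in>UNIV. of_nat (d i)) else 0)"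
  proof (cases "residue m = e")
    case False
    then obtain i where "residue m i \<noteq> e i" by auto
    then have "(\<Prod>i\<in>UNIV. if residue m i = e i then of_nat (d i) else 0 :: 'a) = 0"
      by (intro prod_zero) auto
    then show ?thesis using False by simp
  qed simp
  finally show ?case by (simp add: class_sum_single)
qed (simp add: eval_mpoly_add class_sum_add distrib_right sum.distrib)

lemma class_sum_outside: "\<not> e i < d i \<Longrightarrow> class_sum p e = 0"
  using d_pos[of i] by (auto simp: class_sum_def residue_def intro!: sum.neutral)

lemma residue_less: "residue m i < d i"
  by (simp add: residue_def d_pos)

text \<open>Forward, orthogonality recovers each class sum inside the box up to the nonzero product
  of the \<open>d i\<close>, and outside the box no monomial has the given residue. Backward, the
  value of a monomial on the grid depends only on its residue, so grouping terms by class expresses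
  the value through class sums.\<close>

lemma vanishes_on_grid_iff: "(\<forall>k. eval_mpoly p (grid_point k) = 0) \<longleftrightarrow> (\<forall>e. class_sum p e = 0)"
proof safe
  fix e assume "\<forall>k. eval_mpoly p (grid_point k) = 0"
  then show "class_sum p e = 0"
    using grid_orthogonality[of e p] class_sum_outside[of e _ p] of_nat_d by fastforce
next
  fix k assume *: "\<forall>e. class_sum p e = 0"
  let ?f = "\<lambda>e. \<Prod>i\<in>UNIV. grid_point k i ^ e i"
  let ?R = "residue ` Poly_Mapping.keys p"
  have "eval_mpoly p (grid_point k) = (\<Sum>m\<in>Poly_Mapping.keys p. Poly_Mapping.lookup p m * ?f (residue m))"
    by (simp add: eval_mpoly_def monomial_grid_point_residue)
  also have "\<dots> = (\<Sum>m\<in>Poly_Mapping.keys p. \<Sum>e\<in>?R. Poly_Mapping.lookup p m * (if residue m = e then ?f e else 0))"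
    by (intro sum.cong refl) (simp add: if_distrib cong: if_cong)
  also have "\<dots> = (\<Sum>e\<in>?R. class_sum p e * ?f e)"
    by (subst sum.swap) (auto simp: class_sum_def sum_distrib_right intro!: sum.cong)
  finally show "eval_mpoly p (grid_point k) = 0" by (simp add: *)
qed

end

section \<open>Quotients of vector spaces\<close>

locale vectorspace_quotient = vectorspace K V + N: LinearCombinations.submodule K W V for K V W
begin

abbreviation "Q \<equiv> quot_module V W"
abbreviation "q x \<equiv> W +>\<^bsub>V\<^esub> x"

lemma uminus_closed_W: "x \<in> W \<Longrightarrow> \<ominus>\<^bsub>V\<^esub> x \<in> W"
proof -
  assume x: "x \<in> W"
  then have "(\<ominus>\<^bsub>K\<^esub> \<one>\<^bsub>K\<^esub>) \<odot>\<^bsub>V\<^esub> x \<in> W" by (intro N.smult_closed) simp_all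
  then show ?thesis using x N.subset smult_minus_1[of x] by (simp only: subset_iff)
qed

lemma abelian_subgroup_W: "abelian_subgroup W V"
proof (rule abelian_subgroupI3)
  show "additive_subgroup W V"
  proof (unfold_locales)
    fix x assume "x \<in> W"
    then show "inv\<^bsub>add_monoid V\<^esub> x \<in> W"
      using uminus_closed_W[of x] by (simp add: a_inv_def)
  qed (use N.subset in auto)
qed (rule M.abelian_group_axioms)

interpretation W: abelian_subgroup W V by (rule abelian_subgroup_W)

lemma q_eq_iff:
  assumes "x \<in> carrier V" "y \<in> carrier V"
  shows "q x = q y \<longleftrightarrow> x \<ominus>\<^bsub>V\<^esub> y \<in> W"
proof
  assume "q x = q y"
  then have "x \<in> q y" using W.a_rcos_self[OF assms(1)] by simp
  then show "x \<ominus>\<^bsub>V\<^esub> y \<in> W" using W.a_rcos_module_imp[OF assms(2)] by (simp add: a_minus_def)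
next
  assume "x \<ominus>\<^bsub>V\<^esub> y \<in> W"
  then have "x \<in> q y" using W.a_rcos_module_rev[OF assms(2,1)] by (simp add: a_minus_def)
  then show "q x = q y" using M.a_repr_independence[OF _ assms(2) W.a_subgroup] by simp
qed

lemma carrier_Q: "carrier Q = q ` carrier V"
  by (auto simp: quot_module_def A_RCOSETS_def RCOSETS_def a_r_coset_def)

lemma add_Q: "x \<in> carrier V \<Longrightarrow> y \<in> carrier V \<Longrightarrow> q x \<oplus>\<^bsub>Q\<^esub> q y = q (x \<oplus>\<^bsub>V\<^esub> y)"
  by (simp add: quot_module_def W.a_rcos_sum)

lemma q_eq_W_iff:
  assumes "x \<in> carrier V"
  shows "q x = W \<longleftrightarrow> x \<in> W"
proof -
  have "\<ominus>\<^bsub>V\<^esub> \<zero>\<^bsub>V\<^esub> = \<zero>\<^bsub>V\<^esub>"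
    using M.r_neg[OF M.zero_closed] M.l_zero[of "\<ominus>\<^bsub>V\<^esub> \<zero>\<^bsub>V\<^esub>"] by simp
  then have "x \<ominus>\<^bsub>V\<^esub> \<zero>\<^bsub>V\<^esub> = x" using assms by (simp add: a_minus_def)
  then show ?thesis
    using q_eq_iff[OF assms M.zero_closed] M.a_coset_add_zero[OF N.subset] by simp
qed

lemma zero_Q_eq: "\<zero>\<^bsub>Q\<^esub> = W"
  by (simp add: quot_module_def)

lemma zero_Q: "\<zero>\<^bsub>Q\<^esub> = q \<zero>\<^bsub>V\<^esub>"
  using q_eq_W_iff[of "\<zero>\<^bsub>V\<^esub>"] by (simp add: quot_module_def)

text \<open>\<open>quot_module\<close> takes a union over all elements of the coset; it collapses
  because multiples of elements of one coset lie in one coset.\<close>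

lemma smult_Q:
  assumes "c \<in> carrier K" "x \<in> carrier V"
  shows "c \<odot>\<^bsub>Q\<^esub> q x = q (c \<odot>\<^bsub>V\<^esub> x)"
proof -
  have *: "q (c \<odot>\<^bsub>V\<^esub> y) = q (c \<odot>\<^bsub>V\<^esub> x)" if "y \<in> q x" for y
  proof -
    have y: "y \<in> carrier V" using that M.a_r_coset_subset_G[OF N.subset assms(2)] by blast
    have "y \<ominus>\<^bsub>V\<^esub> x \<in> W" using W.a_rcos_module_imp[OF assms(2) that] by (simp add: a_minus_def)
    then have "c \<odot>\<^bsub>V\<^esub> (y \<ominus>\<^bsub>V\<^esub> x) \<in> W" using assms by simp
    moreover have "c \<odot>\<^bsub>V\<^esub> (y \<ominus>\<^bsub>V\<^esub> x) = c \<odot>\<^bsub>V\<^esub> y \<ominus>\<^bsub>V\<^esub> c \<odot>\<^bsub>V\<^esub> x"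
      using assms y by (simp add: a_minus_def smult_r_distr smult_r_minus)
    ultimately show ?thesis using q_eq_iff[of "c \<odot>\<^bsub>V\<^esub> y" "c \<odot>\<^bsub>V\<^esub> x"] assms y by simp
  qed
  have "c \<odot>\<^bsub>Q\<^esub> q x = (\<Union>y\<in>q x. q (c \<odot>\<^bsub>V\<^esub> y))" by (simp add: quot_module_def)
  also have "\<dots> = (\<Union>y\<in>q x. q (c \<odot>\<^bsub>V\<^esub> x))" by (intro SUP_cong refl *)
  also have "\<dots> = q (c \<odot>\<^bsub>V\<^esub> x)" using W.a_rcos_self[OF assms(2)] by blast
  finally show ?thesis .
qed

lemma vectorspace_Q: "vectorspace K Q"
proof (rule vs_criteria)
  show "field K" by (rule field_axioms)
  show "\<forall>v\<in>carrier Q. \<exists>w\<in>carrier Q. v \<oplus>\<^bsub>Q\<^esub> w = \<zero>\<^bsub>Q\<^esub>"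
  proof
    fix v assume "v \<in> carrier Q"
    then obtain x where x: "v = q x" "x \<in> carrier V" by (auto simp: carrier_Q)
    then have "v \<oplus>\<^bsub>Q\<^esub> q (\<ominus>\<^bsub>V\<^esub> x) = \<zero>\<^bsub>Q\<^esub>" by (simp add: add_Q zero_Q M.r_neg)
    then show "\<exists>w\<in>carrier Q. v \<oplus>\<^bsub>Q\<^esub> w = \<zero>\<^bsub>Q\<^esub>" using x by (auto simp: carrier_Q)
  qed
qed (auto simp: carrier_Q add_Q zero_Q smult_Q M.a_ac smult_l_distr smult_r_distr smult_assoc1)

interpretation Q: vectorspace K Q by (rule vectorspace_Q)

lemma q_closed: "x \<in> carrier V \<Longrightarrow> q x \<in> carrier Q"
  by (simp add: carrier_Q)

lemma q_lincomb:
  assumes "finite E" "b \<in> E \<rightarrow> carrier V" "c \<in> E \<rightarrow> carrier K"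
  shows "(\<Oplus>\<^bsub>Q\<^esub>e\<in>E. c e \<odot>\<^bsub>Q\<^esub> q (b e)) = q (\<Oplus>\<^bsub>V\<^esub>e\<in>E. c e \<odot>\<^bsub>V\<^esub> b e)"
  using assms
proof (induction E rule: finite_induct)
  case (insert e E)
  have b: "b e \<in> carrier V" "\<And>x. x \<in> E \<Longrightarrow> b x \<in> carrier V"
    and c: "c e \<in> carrier K" "\<And>x. x \<in> E \<Longrightarrow> c x \<in> carrier K"
    using insert.prems by auto
  have V: "(\<lambda>e. c e \<odot>\<^bsub>V\<^esub> b e) \<in> E \<rightarrow> carrier V" "c e \<odot>\<^bsub>V\<^esub> b e \<in> carrier V"
    using b c by auto
  have Q: "(\<lambda>e. c e \<odot>\<^bsub>Q\<^esub> q (b e)) \<in> E \<rightarrow> carrier Q" "c e \<odot>\<^bsub>Q\<^esub> q (b e) \<in> carrier Q"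
    using b c q_closed by (auto intro!: Q.smult_closed)
  have "(\<Oplus>\<^bsub>Q\<^esub>e\<in>insert e E. c e \<odot>\<^bsub>Q\<^esub> q (b e))
      = c e \<odot>\<^bsub>Q\<^esub> q (b e) \<oplus>\<^bsub>Q\<^esub> (\<Oplus>\<^bsub>Q\<^esub>e\<in>E. c e \<odot>\<^bsub>Q\<^esub> q (b e))"
    by (rule Q.M.finsum_insert[OF insert.hyps Q])
  also have "\<dots> = q (c e \<odot>\<^bsub>V\<^esub> b e) \<oplus>\<^bsub>Q\<^esub> q (\<Oplus>\<^bsub>V\<^esub>e\<in>E. c e \<odot>\<^bsub>V\<^esub> b e)"
    using insert.IH insert.prems b c by (simp add: smult_Q)
  also have "\<dots> = q (c e \<odot>\<^bsub>V\<^esub> b e \<oplus>\<^bsub>V\<^esub> (\<Oplus>\<^bsub>V\<^esub>e\<in>E. c e \<odot>\<^bsub>V\<^esub> b e))"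
    by (rule add_Q[OF V(2) M.finsum_closed[OF V(1)]])
  also have "c e \<odot>\<^bsub>V\<^esub> b e \<oplus>\<^bsub>V\<^esub> (\<Oplus>\<^bsub>V\<^esub>e\<in>E. c e \<odot>\<^bsub>V\<^esub> b e) = (\<Oplus>\<^bsub>V\<^esub>e\<in>insert e E. c e \<odot>\<^bsub>V\<^esub> b e)"
    by (rule M.finsum_insert[OF insert.hyps V, symmetric])
  finally show ?case .
qed (simp add: zero_Q)

text \<open>The hypotheses say that the classes of the family \<open>b\<close> form a basis modulo
  \<open>W\<close>. They speak of the index set \<open>E\<close>, so injectivity of
  \<open>e \<mapsto> q (b e)\<close> has to be derived before \<open>card E\<close> can be the
  dimension.\<close>

lemma dim_quot:
  assumes fin: "finite E" and b: "b \<in> E \<rightarrow> carrier V"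
    and spans: "\<And>x. x \<in> carrier V \<Longrightarrow>
      \<exists>c\<in>E \<rightarrow> carrier K. x \<ominus>\<^bsub>V\<^esub> (\<Oplus>\<^bsub>V\<^esub>e\<in>E. c e \<odot>\<^bsub>V\<^esub> b e) \<in> W"
    and indep: "\<And>c e. c \<in> E \<rightarrow> carrier K \<Longrightarrow> (\<Oplus>\<^bsub>V\<^esub>e\<in>E. c e \<odot>\<^bsub>V\<^esub> b e) \<in> W \<Longrightarrow> e \<in> E
      \<Longrightarrow> c e = \<zero>\<^bsub>K\<^esub>"
  shows "vectorspace.dim K (quot_module V W) = card E"
proof -
  have bV [simp]: "b e \<in> carrier V" if "e \<in> E" for e using b that by auto
  have inj: "inj_on (\<lambda>e. q (b e)) E"
  proof (rule inj_onI, rule ccontr)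
    fix e e' assume e: "e \<in> E" "e' \<in> E" "q (b e) = q (b e')" "e \<noteq> e'"
    \<comment> \<open>If two classes agreed, these coefficients would produce the difference of
      \<open>b e\<close> and \<open>b e'\<close>, which lies in \<open>W\<close>, against
      \<open>indep\<close>.\<close>
    let ?c = "\<lambda>x. if x = e then \<one>\<^bsub>K\<^esub> else if x = e' then \<ominus>\<^bsub>K\<^esub> \<one>\<^bsub>K\<^esub> else \<zero>\<^bsub>K\<^esub>"
    let ?g = "\<lambda>x. ?c x \<odot>\<^bsub>V\<^esub> b x"
    define E' where "E' = E - {e, e'}"
    have E: "E = insert e (insert e' E')" "e \<notin> insert e' E'" "e' \<notin> E'" "finite E'"
      using e fin by (auto simp: E'_def)
    have g: "?g \<in> A \<rightarrow> carrier V" if "A \<subseteq> E" for A using that by auto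
    have "finsum V ?g E' = finsum V (\<lambda>_. \<zero>\<^bsub>V\<^esub>) E'"
      by (rule M.finsum_cong') (auto simp: E'_def)
    then have "finsum V ?g E' = \<zero>\<^bsub>V\<^esub>" by simp
    moreover have "finsum V ?g (insert e' E') = ?g e' \<oplus>\<^bsub>V\<^esub> finsum V ?g E'"
      by (rule M.finsum_insert) (use E g[of E'] g[of "{e'}"] e in \<open>auto simp: E'_def\<close>)
    moreover have "finsum V ?g E = ?g e \<oplus>\<^bsub>V\<^esub> finsum V ?g (insert e' E')"
      unfolding E(1)
      by (rule M.finsum_insert) (use E g[of "insert e' E'"] g[of "{e}"] e in auto)
    ultimately have "finsum V ?g E = b e \<ominus>\<^bsub>V\<^esub> b e'"
      using e by (simp add: smult_minus_1 a_minus_def)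
    then have "finsum V ?g E \<in> W" using e q_eq_iff[of "b e" "b e'"] by simp
    then have "?c e = \<zero>\<^bsub>K\<^esub>" by (intro indep) (use e in auto)
    then show False by simp
  qed
  let ?B = "(\<lambda>e. q (b e)) ` E"
  have BQ: "?B \<subseteq> carrier Q" by (auto simp: q_closed)
  have lincomb_B: "Q.lincomb a ?B = q (\<Oplus>\<^bsub>V\<^esub>e\<in>E. a (q (b e)) \<odot>\<^bsub>V\<^esub> b e)" if "a \<in> ?B \<rightarrow> carrier K" for a
  proof -
    have "Q.lincomb a ?B = (\<Oplus>\<^bsub>Q\<^esub>e\<in>E. a (q (b e)) \<odot>\<^bsub>Q\<^esub> q (b e))"
      unfolding Q.lincomb_def using that BQ inj by (subst Q.M.add.finprod_reindex) (auto simp: Pi_iff)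
    also have "\<dots> = q (\<Oplus>\<^bsub>V\<^esub>e\<in>E. a (q (b e)) \<odot>\<^bsub>V\<^esub> b e)"
      using that by (intro q_lincomb fin b) auto
    finally show ?thesis .
  qed
  have sumV: "(\<Oplus>\<^bsub>V\<^esub>e\<in>E. c e \<odot>\<^bsub>V\<^esub> b e) \<in> carrier V" if "c \<in> E \<rightarrow> carrier K" for c
    using that by (intro M.finsum_closed) auto
  have "Q.lin_indpt ?B"
  proof (rule Q.finite_lin_indpt2)
    fix a assume a: "a \<in> ?B \<rightarrow> carrier K" and "Q.lincomb a ?B = \<zero>\<^bsub>Q\<^esub>"
    let ?c = "\<lambda>e. a (q (b e))"
    have c: "?c \<in> E \<rightarrow> carrier K" using a by (simp add: Pi_iff)
    have "q (\<Oplus>\<^bsub>V\<^esub>e\<in>E. ?c e \<odot>\<^bsub>V\<^esub> b e) = W"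
      using lincomb_B[OF a] \<open>Q.lincomb a ?B = \<zero>\<^bsub>Q\<^esub>\<close> by (simp only: zero_Q_eq)
    then have "(\<Oplus>\<^bsub>V\<^esub>e\<in>E. ?c e \<odot>\<^bsub>V\<^esub> b e) \<in> W"
      using q_eq_W_iff[OF sumV[OF c]] by simp
    then show "\<forall>v\<in>?B. a v = \<zero>\<^bsub>K\<^esub>"
      using indep[OF c] by blast
  qed (use fin BQ in auto)
  moreover have "Q.span ?B = carrier Q"
  proof
    show "carrier Q \<subseteq> Q.span ?B"
    proof
      fix v assume "v \<in> carrier Q"
      then obtain x where x: "v = q x" "x \<in> carrier V" by (auto simp: carrier_Q)
      from spans[OF x(2)] obtain c where c: "c \<in> E \<rightarrow> carrier K"
        "x \<ominus>\<^bsub>V\<^esub> (\<Oplus>\<^bsub>V\<^esub>e\<in>E. c e \<odot>\<^bsub>V\<^esub> b e) \<in> W" by auto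
      \<comment> \<open>\<open>Q.lincomb\<close> expects coefficients indexed by vectors, so those
        on \<open>E\<close> are transported along the inverse of the injective map.\<close>
      let ?a = "\<lambda>w. c (inv_into E (\<lambda>e. q (b e)) w)"
      have inv: "?a (q (b e)) = c e" if "e \<in> E" for e
        using inv_into_f_f[OF inj that] by simp
      have a: "?a \<in> ?B \<rightarrow> carrier K"
      proof
        fix w assume "w \<in> ?B"
        then obtain e where "e \<in> E" "w = q (b e)" by blast
        then show "?a w \<in> carrier K" using inv[of e] c(1) by auto
      qed
      have "(\<Oplus>\<^bsub>V\<^esub>e\<in>E. ?a (q (b e)) \<odot>\<^bsub>V\<^esub> b e) = (\<Oplus>\<^bsub>V\<^esub>e\<in>E. c e \<odot>\<^bsub>V\<^esub> b e)"
        using c(1) b by (intro M.finsum_cong') (simp_all add: inv Pi_iff)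
      then have "Q.lincomb ?a ?B = q (\<Oplus>\<^bsub>V\<^esub>e\<in>E. c e \<odot>\<^bsub>V\<^esub> b e)"
        by (simp only: lincomb_B[OF a])
      also have "\<dots> = v"
        using c(2) q_eq_iff[OF x(2) sumV[OF c(1)]] x(1) by simp
      finally have "Q.lincomb ?a ?B = v" .
      then show "v \<in> Q.span ?B" using a fin unfolding Q.span_def by blast
    qed
  qed (rule Q.span_is_subset2[OF BQ])
  ultimately have "Q.basis ?B" using BQ by (simp add: Q.basis_def)
  then have "Q.dim = card ?B" using fin by (intro Q.dim_basis) auto
  then show ?thesis using card_image[OF inj] by simp
qed

end

section \<open>The Hilbert function\<close>

lemma poly_alg_smult [simp]: "c \<odot>\<^bsub>poly_alg\<^esub> p = Poly_Mapping.single 0 c * p"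
  by (simp add: poly_alg_def)

text \<open>Bridges the sum of the restricted module record and the type class sum; the vector space
  laws provide the commutative monoid behind \<open>finsum\<close>.\<close>

lemma finsum_homog_part:
  fixes f :: "'e \<Rightarrow> ('n :: finite, 'a :: field) mpoly"
  assumes "vectorspace class_ring (poly_alg\<lparr>carrier := homog_part D\<rparr> :: ('a, ('n, 'a) mpoly) module)"
    and "finite A" "\<And>e. e \<in> A \<Longrightarrow> f e \<in> homog_part D"
  shows "finsum (poly_alg\<lparr>carrier := homog_part D\<rparr>) f A = sum f A"
proof -
  interpret vectorspace class_ring "poly_alg\<lparr>carrier := homog_part D\<rparr> :: ('a, ('n, 'a) mpoly) module" by fact
  show ?thesis
    using assms(2,3)
    by (induction A rule: finite_induct) (simp_all add: M.finsum_insert Pi_iff)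
qed

lemma vectorspace_homog_part:
  "vectorspace class_ring (poly_alg\<lparr>carrier := homog_part D\<rparr> :: ('a :: field, ('n :: finite, 'a) mpoly) module)"
proof (rule vs_criteria)
  show "\<forall>v\<in>carrier (poly_alg\<lparr>carrier := homog_part D\<rparr>).
      \<exists>w\<in>carrier (poly_alg\<lparr>carrier := homog_part D\<rparr>).
        v \<oplus>\<^bsub>poly_alg\<lparr>carrier := homog_part D\<rparr>\<^esub> w = \<zero>\<^bsub>poly_alg\<lparr>carrier := homog_part D\<rparr>\<^esub>"
    using homog_part_uminus by (auto intro!: bexI[of _ "- _"])
qed (auto simp: class_field homog_part_add homog_part_scale add.assoc add.commute mult_single single_add
  distrib_left distrib_right simp flip: mult.assoc)

text \<open>Finiteness of \<open>'n\<close> makes every exponent function finitely supported, so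
  this inverts \<open>lookup\<close>.\<close>

definition mpow :: "('n :: finite \<Rightarrow> nat) \<Rightarrow> ('n \<Rightarrow>\<^sub>0 nat)" where
  "mpow e = Abs_poly_mapping e"

lemma lookup_mpow [simp]: "Poly_Mapping.lookup (mpow e) = e"
  by (simp add: mpow_def)

context exponent_grid
begin

text \<open>Class sums serve as coordinates on the quotient: a form of degree \<open>D\<close> lies
  in \<open>I\<close> iff they all vanish, and only classes containing a monomial of degree
  \<open>D\<close> matter. One such monomial per class gives a basis of the quotient.\<close>

lemma hilbert_fun_eq_card_residues:
  assumes I: "I \<inter> homog_part D = {p \<in> homog_part D. \<forall>k. eval_mpoly p (grid_point k) = 0}"
  shows "hilbert_fun I D = card (residue ` {m. mdeg m = D})"
proof -
  let ?V = "poly_alg\<lparr>carrier := homog_part D\<rparr> :: ('a, ('n, 'a) mpoly) module"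
  let ?W = "I \<inter> homog_part D"
  let ?E = "residue ` {m. mdeg m = D}"
  have W_iff: "p \<in> ?W \<longleftrightarrow> p \<in> homog_part D \<and> (\<forall>e. class_sum p e = 0)" for p
    by (simp only: I mem_Collect_eq vanishes_on_grid_iff)
  interpret V: vectorspace class_ring ?V by (rule vectorspace_homog_part)
  interpret W: vectorspace_quotient class_ring ?V ?W
  proof (intro vectorspace_quotient.intro LinearCombinations.submodule.intro)
    show "vectorspace class_ring ?V" "Module.module class_ring ?V"
      by unfold_locales
    have scale: "class_sum (Poly_Mapping.single 0 c * p) e = c * class_sum p e" for c p e
    proof (induction p rule: mpoly_induct)
      case (single m c')
      then show ?case by (simp add: mult_single class_sum_single)
    qed (simp add: distrib_left class_sum_add)
    fix c :: 'a and p assume "c \<in> carrier class_ring" "p \<in> ?W"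
    then show "c \<odot>\<^bsub>?V\<^esub> p \<in> ?W"
      by (simp only: W_iff) (simp add: homog_part_scale scale)
  next
    fix p p' assume "p \<in> ?W" "p' \<in> ?W"
    then show "p \<oplus>\<^bsub>?V\<^esub> p' \<in> ?W"
      by (simp only: W_iff) (simp add: homog_part_add class_sum_add)
  next
    show "\<zero>\<^bsub>?V\<^esub> \<in> ?W" by (simp only: W_iff) (simp add: class_sum_def)
  qed simp
  define b where "b e = Poly_Mapping.single (SOME m. mdeg m = D \<and> residue m = e) (1 :: 'a)" for e
  have rep: "mdeg (SOME m. mdeg m = D \<and> residue m = e) = D \<and> residue (SOME m. mdeg m = D \<and> residue m = e) = e"
    if "e \<in> ?E" for e
    by (rule someI_ex) (use that in auto)
  have b: "b e \<in> homog_part D" if "e \<in> ?E" for e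
    using rep[OF that] by (simp add: b_def homog_part_single)
  have fin: "finite ?E"
    by (rule finite_subset[of _ grid_indices]) (auto simp: residue_less intro!: finite_PiE)
  have class_sum_b: "class_sum (Poly_Mapping.single 0 c * b e) e' = (if e' = e then c else 0)"
    if "e \<in> ?E" for c e e'
    using rep[OF that] by (auto simp: b_def mult_single class_sum_single)
  have sum_eq: "(\<Oplus>\<^bsub>?V\<^esub>e\<in>?E. c e \<odot>\<^bsub>?V\<^esub> b e) = (\<Sum>e\<in>?E. Poly_Mapping.single 0 (c e) * b e)" for c
    using finsum_homog_part[OF vectorspace_homog_part fin, of "\<lambda>e. Poly_Mapping.single 0 (c e) * b e"] b
    by (simp add: homog_part_scale)
  have class_sum_lincomb: "class_sum (\<Sum>e\<in>?E. Poly_Mapping.single 0 (c e) * b e) e' = (if e' \<in> ?E then c e' else 0)"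
    for c e'
    using fin by (simp add: class_sum_sum class_sum_b cong: sum.cong)
  have minus_eq: "p \<ominus>\<^bsub>?V\<^esub> p' = p - p'" if "p' \<in> homog_part D" for p p'
  proof -
    have "\<ominus>\<^bsub>?V\<^esub> p' = - p'"
      using V.M.minus_equality[of "- p'" p'] that homog_part_uminus[OF that] by simp
    then show ?thesis by (simp add: a_minus_def)
  qed
  have "vectorspace.dim class_ring (quot_module ?V ?W) = card ?E"
  proof (rule W.dim_quot[OF fin, of b])
    show "b \<in> ?E \<rightarrow> carrier ?V" using b by auto
  next
    fix p assume p: "p \<in> carrier ?V"
    let ?s = "\<Sum>e\<in>?E. Poly_Mapping.single 0 (class_sum p e) * b e"
    have s: "?s \<in> homog_part D" by (intro homog_part_sum homog_part_scale b)
    \<comment> \<open>A form of degree \<open>D\<close> has no terms in a class without monomials of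
      degree \<open>D\<close>.\<close>
    have outside: "class_sum p e = 0" if "e \<notin> ?E" for e
      unfolding class_sum_def using p that by (intro sum.neutral) (auto simp: homog_part_iff)
    have "p - ?s \<in> ?W"
      using p s homog_part_add[OF _ homog_part_uminus, of p D ?s] outside
        class_sum_add[of p "- ?s"] class_sum_uminus[of ?s] class_sum_lincomb[of "class_sum p"]
      by (simp only: W_iff) auto
    then show "\<exists>c\<in>?E \<rightarrow> carrier class_ring. p \<ominus>\<^bsub>?V\<^esub> (\<Oplus>\<^bsub>?V\<^esub>e\<in>?E. c e \<odot>\<^bsub>?V\<^esub> b e) \<in> ?W"
      unfolding sum_eq using minus_eq[OF s] by (intro bexI[of _ "class_sum p"]) auto
  next
    fix c :: "('n \<Rightarrow> nat) \<Rightarrow> 'a" and e assume "(\<Oplus>\<^bsub>?V\<^esub>e\<in>?E. c e \<odot>\<^bsub>?V\<^esub> b e) \<in> ?W" and e: "e \<in> ?E"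
    then have "class_sum (\<Sum>e\<in>?E. Poly_Mapping.single 0 (c e) * b e) e = 0"
      unfolding sum_eq by (simp only: W_iff)
    then show "c e = \<zero>\<^bsub>class_ring\<^esub>" using e by (simp add: class_sum_lincomb)
  qed
  then show ?thesis by (simp add: hilbert_fun_def)
qed

text \<open>Euclidean division of each exponent by \<open>d i\<close>: the remainders give
  \<open>e\<close>, and the quotients are the coefficients of the semigroup element.\<close>

lemma residues_of_degree:
  "residue ` {m. mdeg m = D} = {e. (\<forall>i. e i < d i) \<and> (\<exists>s\<in>semigroup_gen d. (\<Sum>i\<in>UNIV. e i) + s = D)}"
proof (intro equalityI subsetI)
  fix e assume "e \<in> residue ` {m. mdeg m = D}"
  then obtain m where m: "e = residue m" "mdeg m = D" by auto
  have "(\<Sum>i\<in>UNIV. e i) + (\<Sum>i\<in>UNIV. (Poly_Mapping.lookup m i div d i) * d i) = D"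
    using m by (simp add: residue_def mdeg_def flip: sum.distrib)
  then show "e \<in> {e. (\<forall>i. e i < d i) \<and> (\<exists>s\<in>semigroup_gen d. (\<Sum>i\<in>UNIV. e i) + s = D)}"
    using m(1) residue_less by (fastforce simp: semigroup_gen_def)
next
  fix e assume "e \<in> {e. (\<forall>i. e i < d i) \<and> (\<exists>s\<in>semigroup_gen d. (\<Sum>i\<in>UNIV. e i) + s = D)}"
  then obtain c where c: "\<forall>i. e i < d i" "(\<Sum>i\<in>UNIV. e i) + (\<Sum>i\<in>UNIV. c i * d i) = D"
    by (auto simp: semigroup_gen_def)
  let ?m = "mpow (\<lambda>i. e i + c i * d i)"
  have "mdeg ?m = D" using c by (simp add: mdeg_def sum.distrib)
  moreover have "residue ?m = e" using c by (auto simp: residue_def)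
  ultimately show "e \<in> residue ` {m. mdeg m = D}" by force
qed

end

section \<open>Krull dimension\<close>

text \<open>Phrased by closure properties because it is applied to preimages under
  \<open>poly_at\<close>. A nonzero element of least degree is a generator by division with
  remainder; the zero ideal has generator 0.\<close>

lemma poly_ideal_principal:
  fixes J :: "'a :: field poly set"
  assumes "J \<noteq> {}" and diff: "\<And>x y. x \<in> J \<Longrightarrow> y \<in> J \<Longrightarrow> x - y \<in> J"
    and mult: "\<And>x y. x \<in> J \<Longrightarrow> x * y \<in> J"
  obtains u where "u \<in> J" "\<And>h. h \<in> J \<Longrightarrow> u dvd h"
proof (cases "J \<subseteq> {0}")
  case True
  then have "J = {0}" using assms(1) by blast
  then show ?thesis using that[of 0] by simp
next
  case False
  then obtain g where "g \<in> J \<and> g \<noteq> 0" by auto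
  then obtain u where u: "u \<in> J" "u \<noteq> 0" and least: "\<And>h. h \<in> J \<Longrightarrow> h \<noteq> 0 \<Longrightarrow> degree u \<le> degree h"
    using ex_has_least_nat[of "\<lambda>g. g \<in> J \<and> g \<noteq> 0" g degree] by auto
  have "u dvd h" if "h \<in> J" for h
  proof -
    have "h mod u = h - u * (h div u)" by (simp add: minus_mult_div_eq_mod)
    then have "h mod u \<in> J" using diff[OF that mult[OF u(1)]] by simp
    then have "h mod u = 0" using least[of "h mod u"] degree_mod_less'[of u h] u(2) by force
    then show ?thesis by (simp add: dvd_eq_mod_eq_0)
  qed
  then show ?thesis using that u by blast
qed

section \<open>Variables as generators, and evaluation of univariate polynomials at a multivariate
  one\<close>

definition mvar :: "'n \<Rightarrow> ('n :: finite, 'a :: field) mpoly" where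
  "mvar i = Poly_Mapping.single (Poly_Mapping.single i 1) 1"

lemma eval_mpoly_mvar [simp]: "eval_mpoly (mvar i) x = x i"
proof -
  have "(\<Prod>k\<in>UNIV. x k ^ Poly_Mapping.lookup (Poly_Mapping.single i 1) k) = (\<Prod>k\<in>UNIV. if k = i then x k else 1)"
    by (intro prod.cong) (auto simp: lookup_single when_def)
  then show ?thesis by (simp add: mvar_def eval_mpoly_single)
qed

lemma mvar_homog_part: "mvar i \<in> homog_part 1"
  unfolding mvar_def by (rule homog_part_single) (simp add: mdeg_def lookup_single when_def)

text \<open>By induction on the total degree, a monomial splits off one variable at a time. Serves
  to reduce polynomials modulo a line.\<close>

lemma mpoly_generators_induct [case_names const var add mult]:
  fixes P :: "('n :: finite, 'a :: field) mpoly \<Rightarrow> bool"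
  assumes const: "\<And>c. P (Poly_Mapping.single 0 c)" and var: "\<And>i. P (mvar i)"
    and add: "\<And>p q. P p \<Longrightarrow> P q \<Longrightarrow> P (p + q)" and mult: "\<And>p q. P p \<Longrightarrow> P q \<Longrightarrow> P (p * q)"
  shows "P p"
proof (induction p rule: mpoly_induct)
  case (single m c)
  have "P (Poly_Mapping.single m 1)" if "mdeg m = N" for N m
    using that
  proof (induction N arbitrary: m)
    case 0
    then have "m = 0" by (intro poly_mapping_eqI) (simp add: mdeg_def)
    then show ?case using const[of 1] by simp
  next
    case (Suc N)
    then obtain i where i: "Poly_Mapping.lookup m i \<noteq> 0"
      by (metis mdeg_def sum.neutral Zero_not_Suc)
    \<comment> \<open>The exponent of \<open>i\<close> is positive, so the truncated subtraction is
      exact.\<close>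
    have m: "m = (m - Poly_Mapping.single i 1) + Poly_Mapping.single i 1"
      using i by (intro poly_mapping_eqI) (auto simp: lookup_add lookup_minus lookup_single when_def)
    have "mdeg (Poly_Mapping.single i 1) = 1"
      by (simp add: mdeg_def lookup_single when_def)
    then have "mdeg (m - Poly_Mapping.single i 1) = N"
      using Suc.prems m mdeg_add[of "m - Poly_Mapping.single i 1" "Poly_Mapping.single i 1"] by simp
    then have "P (Poly_Mapping.single (m - Poly_Mapping.single i 1) 1 * mvar i)"
      by (intro mult Suc.IH var)
    then show ?case using m by (simp add: mvar_def mult_single)
  qed
  then have "P (Poly_Mapping.single 0 c * Poly_Mapping.single m 1)"
    by (intro mult const) auto
  then show ?case by (simp add: mult_single)
qed (rule add)

interpretation mconst: comm_ring_hom "Poly_Mapping.single 0 :: 'a :: field \<Rightarrow> ('n :: finite, 'a) mpoly"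
  by unfold_locales (simp_all add: single_add mult_single)

interpretation mconst_poly: map_poly_comm_ring_hom "Poly_Mapping.single 0 :: 'a :: field \<Rightarrow> ('n :: finite, 'a) mpoly" ..

text \<open>The substitution homomorphism sending the indeterminate to \<open>t\<close>;
  coefficients become constants of the multivariate ring.\<close>

definition poly_at :: "('n :: finite, 'a :: field) mpoly \<Rightarrow> 'a poly \<Rightarrow> ('n, 'a) mpoly" where
  "poly_at t g = poly (map_poly (Poly_Mapping.single 0) g) t"

lemma poly_at_add: "poly_at t (g + h) = poly_at t g + poly_at t h"
  by (simp add: poly_at_def mconst_poly.hom_add)

lemma poly_at_diff: "poly_at t (g - h) = poly_at t g - poly_at t h"
  by (simp add: poly_at_def mconst_poly.hom_minus)

lemma poly_at_mult: "poly_at t (g * h) = poly_at t g * poly_at t h"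
  by (simp add: poly_at_def mconst_poly.hom_mult)

lemma poly_at_const: "poly_at t [:c:] = Poly_Mapping.single 0 c"
  by (simp add: poly_at_def Polynomial.map_poly_pCons)

lemma poly_at_X: "poly_at t [:0, c:] = Poly_Mapping.single 0 c * t"
  by (simp add: poly_at_def Polynomial.map_poly_pCons mult.commute)

section \<open>Prime ideals and chains of them\<close>

lemma primeideal_poly_algD:
  assumes "primeideal P (poly_alg :: ('a :: field, ('n :: finite, 'a) mpoly) module)"
  shows "0 \<in> P" "x \<in> P \<Longrightarrow> y \<in> P \<Longrightarrow> x + y \<in> P" "x \<in> P \<Longrightarrow> y \<in> P \<Longrightarrow> x - y \<in> P"
    "x \<in> P \<Longrightarrow> x * y \<in> P" "x \<in> P \<Longrightarrow> y * x \<in> P" "x * y \<in> P \<Longrightarrow> x \<in> P \<or> y \<in> P" "1 \<notin> P"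
proof -
  interpret primeideal P "poly_alg :: ('a :: field, ('n :: finite, 'a) mpoly) module" by fact
  show "0 \<in> P" using zero_closed by simp
  show add: "x + y \<in> P" if "x \<in> P" "y \<in> P" for x y using a_closed[OF that] by simp
  show mult: "x * y \<in> P" if "x \<in> P" for x y using I_r_closed[of x y] that by simp
  show "x - y \<in> P" if "x \<in> P" "y \<in> P" using add[OF that(1) mult[OF that(2), of "- 1"]] by simp
  show "y * x \<in> P" if "x \<in> P" using mult[OF that, of y] by (simp add: mult.commute)
  show "x * y \<in> P \<Longrightarrow> x \<in> P \<or> y \<in> P" using I_prime[of x y] by simp
  show "1 \<notin> P" using one_imp_carrier I_notcarr by auto
qed

lemma primeideal_prodD:
  assumes P: "primeideal P (poly_alg :: ('a :: field, ('n :: finite, 'a) mpoly) module)"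
    and "finite A" "prod f A \<in> P"
  shows "\<exists>j\<in>A. f j \<in> P"
  using assms(2,3)
proof (induction A rule: finite_induct)
  case empty
  then show ?case using primeideal_poly_algD(7)[OF P] by simp
next
  case (insert a A)
  then show ?case using primeideal_poly_algD(6)[OF P, of "f a" "prod f A"] by auto
qed

text \<open>Modulo \<open>P0\<close> every variable is a scalar multiple of \<open>mvar j\<close>,
  so every polynomial is congruent to a univariate one in \<open>mvar j\<close>. The contradiction
  is that nonzero primes of the principal ideal domain \<open>K[x]\<close> are maximal, applied to
  the preimages of \<open>P1\<close> and \<open>P2\<close>.\<close>

lemma no_prime_chain_over_line:
  fixes P0 P1 P2 :: "('n :: finite, 'a :: field) mpoly set"
  assumes P: "primeideal P0 poly_alg" "primeideal P1 poly_alg" "primeideal P2 poly_alg"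
    and sub: "P0 \<subset> P1" "P1 \<subset> P2"
    and line: "\<And>i. \<exists>c. mvar i - Poly_Mapping.single 0 c * mvar j \<in> P0"
  shows False
proof -
  note D0 = primeideal_poly_algD[OF P(1)]
  note D1 = primeideal_poly_algD[OF P(2)]
  note D2 = primeideal_poly_algD[OF P(3)]
  let ?\<psi> = "poly_at (mvar j) :: 'a poly \<Rightarrow> ('n, 'a) mpoly"
  have red: "\<exists>g. f - ?\<psi> g \<in> P0" for f
  proof (induction f rule: mpoly_generators_induct)
    case (const c)
    show ?case by (rule exI[of _ "[:c:]"]) (simp add: poly_at_const D0)
  next
    case (var i)
    obtain c where "mvar i - Poly_Mapping.single 0 c * mvar j \<in> P0" using line by blast
    then show ?case by (intro exI[of _ "[:0, c:]"]) (simp add: poly_at_X)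
  next
    case (add p q)
    then obtain g h where "p - ?\<psi> g \<in> P0" "q - ?\<psi> h \<in> P0" by blast
    then have "(p - ?\<psi> g) + (q - ?\<psi> h) \<in> P0" by (rule D0(2))
    then show ?case by (intro exI[of _ "g + h"]) (simp add: poly_at_add algebra_simps)
  next
    case (mult p q)
    then obtain g h where "p - ?\<psi> g \<in> P0" "q - ?\<psi> h \<in> P0" by blast
    then have "(p - ?\<psi> g) * q + ?\<psi> g * (q - ?\<psi> h) \<in> P0" by (intro D0(2,4,5))
    then show ?case by (intro exI[of _ "g * h"]) (simp add: poly_at_mult algebra_simps)
  qed
  \<comment> \<open>Strict inclusions above \<open>P0\<close> are visible on univariate polynomials,
    since changing \<open>f\<close> by an element of \<open>P0\<close> affects membership in neither
    set.\<close>
  have lift: "\<exists>g. ?\<psi> g \<in> B \<and> ?\<psi> g \<notin> A"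
    if prems: "P0 \<subseteq> A" "A \<subset> B" "\<And>x y. x \<in> A \<Longrightarrow> y \<in> A \<Longrightarrow> x + y \<in> A"
      "\<And>x y. x \<in> B \<Longrightarrow> y \<in> B \<Longrightarrow> x - y \<in> B" for A B
  proof -
    obtain f where f: "f \<in> B" "f \<notin> A" using prems by blast
    obtain g where g: "f - ?\<psi> g \<in> P0" using red by blast
    have "f - (f - ?\<psi> g) \<in> B" using prems f g by blast
    moreover have "?\<psi> g \<notin> A" using prems(3)[of "f - ?\<psi> g" "?\<psi> g"] prems(1) f g by auto
    ultimately show ?thesis by auto
  qed
  have gen: "\<exists>u. ?\<psi> u \<in> A \<and> (\<forall>h. ?\<psi> h \<in> A \<longrightarrow> u dvd h)"
    if "0 \<in> A" "\<And>x y. x \<in> A \<Longrightarrow> y \<in> A \<Longrightarrow> x - y \<in> A" "\<And>x y. x \<in> A \<Longrightarrow> x * y \<in> A" for A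
  proof (rule poly_ideal_principal[of "{g. ?\<psi> g \<in> A}"])
    have "?\<psi> 0 \<in> A" using that(1) poly_at_const[of "mvar j :: ('n, 'a) mpoly" 0] by simp
    then show "{g. ?\<psi> g \<in> A} \<noteq> {}" by blast
  qed (use that in \<open>auto simp: poly_at_diff poly_at_mult\<close>)
  obtain g where g: "?\<psi> g \<in> P1" and g_dvd: "\<And>h. ?\<psi> h \<in> P1 \<Longrightarrow> g dvd h"
    using gen[of P1] D1 by blast
  obtain u where u: "?\<psi> u \<in> P2" and u_dvd: "\<And>h. ?\<psi> h \<in> P2 \<Longrightarrow> u dvd h"
    using gen[of P2] D2 by blast
  \<comment> \<open>With \<open>g = 0\<close> the preimage of \<open>P1\<close> would be zero, but
    \<open>lift\<close> gives a polynomial with image in \<open>P1\<close> and not in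
    \<open>P0\<close>.\<close>
  have "g \<noteq> 0"
    using lift[OF order_refl sub(1) D0(2) D1(3)] g_dvd D0(1) by (fastforce simp: poly_at_const[of _ 0, simplified])
  have "u dvd g" by (rule u_dvd) (use g sub(2) in blast)
  then obtain w where w: "g = u * w" by (elim dvdE)
  \<comment> \<open>Primality of \<open>P1\<close> leaves two cases: the first puts all univariate
    elements of \<open>P2\<close> into \<open>P1\<close>, the second makes \<open>u\<close> a unit,
    so that 1 lies in \<open>P2\<close>.\<close>
  consider "?\<psi> u \<in> P1" | "?\<psi> w \<in> P1" using D1(6)[of "?\<psi> u" "?\<psi> w"] g w by (auto simp: poly_at_mult)
  then show False
  proof cases
    case 1
    have "?\<psi> h \<in> P1" if "?\<psi> h \<in> P2" for h
      using u_dvd[OF that] D1(4)[OF 1] by (auto simp: poly_at_mult elim!: dvdE)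
    then show False using lift[of P1 P2] sub D1(2) D2(3) by blast
  next
    case 2
    have "u * w dvd 1 * w" using g_dvd[OF 2] w by simp
    then have "u dvd 1" using \<open>g \<noteq> 0\<close> w by (subst (asm) dvd_mult_cancel_right) simp
    then obtain u' where "1 = u * u'" by (elim dvdE)
    then have "?\<psi> 1 = ?\<psi> u * ?\<psi> u'" by (metis poly_at_mult)
    then have "?\<psi> 1 \<in> P2" using D2(4)[OF u] by simp
    then show False using D2(7) poly_at_const[of "mvar j :: ('n, 'a) mpoly" 1] by (simp add: one_pCons)
  qed
qed

text \<open>A chain of length at least 2 in the quotient yields three primes above \<open>I\<close>
  by pullback. The smallest contains a factor of each product, which is the hypothesis
  \<open>line\<close> of \<open>no_prime_chain_over_line\<close>.\<close>

lemma krull_dim_quot_le_1: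
  fixes I :: "('n :: finite, 'a :: {field, finite}) mpoly set"
  assumes I: "ideal I poly_alg"
    and prod: "\<And>i j. (\<Prod>c\<in>UNIV - {0}. mvar i - Poly_Mapping.single 0 c * mvar j) \<in> I"
  shows "krull_dim (poly_alg Quot I) \<le> 1"
  unfolding krull_dim_def
proof (rule Sup_least, safe)
  fix l P assume chain: "prime_chain (poly_alg Quot I) P l"
  show "enat l \<le> 1"
  proof (rule ccontr)
    assume "\<not> enat l \<le> 1"
    then have l: "2 \<le> l" by (simp add: one_enat_def)
    have prime: "primeideal (P k) (poly_alg Quot I)" if "k \<le> 2" for k
      using chain l that by (auto simp: prime_chain_def)
    have sub: "P 0 \<subset> P 1" "P 1 \<subset> P 2"
      using chain l by (auto simp: prime_chain_def numeral_2_eq_2)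
    interpret I: ideal I poly_alg by fact
    interpret pr: ring_hom_ring poly_alg "poly_alg Quot I" "(+>\<^bsub>poly_alg\<^esub>) I"
      by (rule I.rcos_ring_hom_ring)
    define R where "R k = {f. I +>\<^bsub>poly_alg\<^esub> f \<in> P k}" for k
    have R: "primeideal (R k) poly_alg" if "k \<le> 2" for k
      using pr.primeideal_vimage[OF poly_alg.is_cring prime[OF that]] by (simp add: R_def)
    have R_sub: "R k \<subset> R k'" if k: "P k \<subset> P k'" "k' \<le> 2" for k k'
    proof -
      interpret P': primeideal "P k'" "poly_alg Quot I" using k by (intro prime)
      \<comment> \<open>Strictness survives the pullback because every element of the quotient is
        the coset of some \<open>f\<close>.\<close>
      obtain X where X: "X \<in> P k'" "X \<notin> P k" using k by blast
      then have "X \<in> carrier (poly_alg Quot I)" using P'.a_subset by blast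
      then obtain f where "X = I +>\<^bsub>poly_alg\<^esub> f"
        by (auto simp: FactRing_def A_RCOSETS_def RCOSETS_def a_r_coset_def)
      then show ?thesis using X k by (auto simp: R_def)
    qed
    have I_R: "I \<subseteq> R 0"
    proof
      fix f assume "f \<in> I"
      then have "I +>\<^bsub>poly_alg\<^esub> f = \<zero>\<^bsub>poly_alg Quot I\<^esub>"
        using poly_alg.a_coset_join2[of f I] I.a_subgroup by (simp add: FactRing_def)
      moreover have "\<zero>\<^bsub>poly_alg Quot I\<^esub> \<in> P 0"
        using prime[of 0] by (simp add: additive_subgroup.zero_closed ideal.axioms(1) primeideal.axioms(1))
      ultimately show "f \<in> R 0" by (simp add: R_def)
    qed
    have "\<exists>c. mvar i - Poly_Mapping.single 0 c * mvar j \<in> R 0" for i j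
      using primeideal_prodD[OF R[of 0] _ subsetD[OF I_R prod[of i j]]] by auto
    then show False
      using no_prime_chain_over_line[OF R[of 0] R[of 1] R[of 2]] R_sub sub by auto
  qed
qed

section \<open>Numerical semigroups and boxes\<close>

lemma bezout_Gcd_family:
  fixes a :: "'i \<Rightarrow> nat"
  assumes "finite A"
  shows "\<exists>z. (\<Sum>i\<in>A. z i * int (a i)) = int (Gcd (a ` A))"
  using assms
proof (induction A rule: finite_induct)
  case empty
  then show ?case by simp
next
  case (insert k A)
  then obtain z where z: "(\<Sum>i\<in>A. z i * int (a i)) = int (Gcd (a ` A))" by blast
  obtain u w where uw: "u * int (a k) + w * int (Gcd (a ` A)) = gcd (int (a k)) (int (Gcd (a ` A)))"
    using bezout_int by blast
  let ?z = "\<lambda>i. if i = k then u else w * z i"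
  have "(\<Sum>i\<in>A. ?z i * int (a i)) = w * (\<Sum>i\<in>A. z i * int (a i))"
    unfolding sum_distrib_left using insert.hyps by (intro sum.cong) auto
  then have "(\<Sum>i\<in>insert k A. ?z i * int (a i)) = int (Gcd (a ` insert k A))"
    using insert.hyps uw z by simp
  then show ?case by (intro exI[of _ ?z])
qed

lemma semigroup_gen_closed:
  assumes "x \<in> semigroup_gen a" "y \<in> semigroup_gen a"
  shows "k * x + l * y \<in> semigroup_gen a"
proof -
  obtain b c where "x = (\<Sum>i\<in>UNIV. b i * a i)" "y = (\<Sum>i\<in>UNIV. c i * a i)"
    using assms by (auto simp: semigroup_gen_def)
  then have "k * x + l * y = (\<Sum>i\<in>UNIV. (k * b i + l * c i) * a i)"
    by (simp add: sum_distrib_left sum.distrib algebra_simps)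
  then show ?thesis by (auto simp: semigroup_gen_def)
qed

lemma generator_in_semigroup_gen: "a i \<in> semigroup_gen a"
proof -
  have "(\<Sum>k\<in>UNIV. (if k = i then 1 else 0) * a k) = (\<Sum>k\<in>UNIV. if k = i then a k else 0)"
    by (intro sum.cong) auto
  then have eq: "a i = (\<Sum>k\<in>UNIV. (if k = i then 1 else 0) * a k)" by simp
  show ?thesis
    unfolding semigroup_gen_def by (intro CollectI exI[of _ "\<lambda>k. if k = i then 1 else 0"] conjI TrueI eq)
qed

lemma semigroup_gen_scale: "semigroup_gen (\<lambda>i. r * a i) = (*) r ` semigroup_gen a"
proof -
  have "(\<Sum>i\<in>UNIV. c i * (r * a i)) = r * (\<Sum>i\<in>UNIV. c i * a i)" for c
    by (simp add: sum_distrib_left mult.left_commute)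
  then show ?thesis by (auto simp: semigroup_gen_def)
qed

text \<open>A semigroup element \<open>u\<close> congruent to 1 modulo a generator serves every
  residue: \<open>m\<close> and the product of \<open>m mod ?N\<close> and \<open>u\<close> differ
  by a multiple of \<open>?N\<close>, which is nonnegative once \<open>m\<close> is at least
  \<open>?N * u\<close>.\<close>

lemma semigroup_gen_contains_large:
  fixes a :: "'n :: finite \<Rightarrow> nat"
  assumes pos: "\<And>i. 0 < a i" and gcd: "(GCD i. a i) = 1"
  shows "\<exists>N. \<forall>m\<ge>N. m \<in> semigroup_gen a"
proof -
  \<comment> \<open>Types are nonempty, so some index exists.\<close>
  fix j :: 'n
  let ?N = "a j"
  obtain z where z: "(\<Sum>i\<in>UNIV. z i * int (a i)) = 1"
    using bezout_Gcd_family[of UNIV a] gcd by auto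
  \<comment> \<open>Reducing the Bezout coefficients modulo one generator makes them nonnegative.\<close>
  define u where "u = (\<Sum>i\<in>UNIV. nat (z i mod int ?N) * a i)"
  have u: "u \<in> semigroup_gen a" by (auto simp: u_def semigroup_gen_def)
  have "int u = (\<Sum>i\<in>UNIV. (z i mod int ?N) * int (a i))"
    using pos[of j] by (simp add: u_def)
  then have "int u mod int ?N = (\<Sum>i\<in>UNIV. z i * int (a i)) mod int ?N"
    by (simp add: mod_sum_eq[symmetric, of "\<lambda>i. (z i mod int ?N) * int (a i)"]
        mod_sum_eq[symmetric, of "\<lambda>i. z i * int (a i)"] mod_mult_left_eq)
  then have u_mod: "u mod ?N = 1 mod ?N"
    using z by (metis of_nat_1 of_nat_eq_iff zmod_int)
  show ?thesis
  proof (intro exI[of _ "?N * u"] allI impI)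
    fix m assume m: "?N * u \<le> m"
    let ?x = "(m mod ?N) * u"
    have le: "?x \<le> m"
      using m pos[of j] by (meson le_trans less_imp_le_nat mod_less_divisor mult_le_mono1)
    have "?x mod ?N = m mod ?N"
      using mod_mult_right_eq[of "m mod ?N" u ?N] mod_mult_right_eq[of "m mod ?N" 1 ?N] u_mod by simp
    then have "?N dvd m - ?x" using le by (metis mod_eq_dvd_iff_nat)
    then obtain k where "m - ?x = k * ?N" by (metis dvdE mult.commute)
    then have "m = (m mod ?N) * u + k * ?N" using le by simp
    then show "m \<in> semigroup_gen a"
      using semigroup_gen_closed[OF u generator_in_semigroup_gen] by metis
  qed
qed

text \<open>\<open>-1\<close> is never the image of a natural number, and all non-members lie below
  \<open>N\<close>; so a greatest one exists and is at least \<open>-1\<close>, which makes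
  \<open>GREATEST\<close> meaningful.\<close>

lemma frobenius_number_props:
  assumes "\<forall>m\<ge>N. m \<in> A"
  shows "frobenius_number A \<notin> int ` A" "\<And>z. frobenius_number A < z \<Longrightarrow> z \<in> int ` A"
    "-1 \<le> frobenius_number A"
proof -
  let ?F = "{z \<in> {-1..int N}. z \<notin> int ` A}"
  have fin: "finite ?F" by (rule finite_subset[of _ "{-1..int N}"]) auto
  have mem: "-1 \<in> ?F" by auto
  define g where "g = Max ?F"
  have g: "g \<in> ?F" unfolding g_def using fin mem by (intro Max_in) auto
  have ge: "z \<le> g" if "z \<notin> int ` A" for z
  proof (cases "z < -1")
    case True
    then show ?thesis using Max_ge[OF fin mem] by (simp add: g_def)
  next
    case False
    have "\<not> int N \<le> z"
    proof
      assume "int N \<le> z"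
      then have "nat z \<in> A" "z = int (nat z)" using assms by auto
      then show False using that by blast
    qed
    then have "z \<in> ?F" using False that by auto
    then show ?thesis unfolding g_def by (rule Max_ge[OF fin])
  qed
  have "frobenius_number A = g"
    unfolding frobenius_number_def using g ge by (intro Greatest_equality) auto
  then show "frobenius_number A \<notin> int ` A" "\<And>z. frobenius_number A < z \<Longrightarrow> z \<in> int ` A"
    "-1 \<le> frobenius_number A"
    using g ge by (auto simp: not_less[symmetric])
qed

section \<open>Counting box points by their coordinate sum\<close>

definition box :: "('n :: finite \<Rightarrow> nat) \<Rightarrow> ('n \<Rightarrow> nat) set" where
  "box d = {e. \<forall>i. e i < d i}"

lemma box_eq_PiE: "box d = PiE UNIV (\<lambda>i. {..<d i})"
  by (auto simp: box_def PiE_def)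

lemma finite_box: "finite (box d)"
  unfolding box_eq_PiE by (intro finite_PiE) auto

lemma card_box: "card (box d) = (\<Prod>i\<in>UNIV. d i)"
  unfolding box_eq_PiE by (subst card_PiE) auto

lemma card_box_sum_mod_le:
  fixes d :: "'n :: finite \<Rightarrow> nat"
  assumes dvd: "\<And>i. r dvd d i" and pos: "\<And>i. 0 < d i" and "0 < r"
  shows "card {e \<in> box d. (\<Sum>i\<in>UNIV. e i) mod r = x mod r}
    \<le> card {e \<in> box d. (\<Sum>i\<in>UNIV. e i) mod r = y mod r}"
proof -
  fix j :: 'n
  \<comment> \<open>Congruent to \<open>y - x\<close> modulo \<open>r\<close> without subtracting
    naturals, as \<open>x + ?t = y + r * x\<close>.\<close>
  let ?t = "y + (r - 1) * x"
  \<comment> \<open>Cyclically shifting one coordinate by t shifts the coordinate sum by t modulo r.\<close>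
  let ?shift = "\<lambda>e. e(j := (e j + ?t) mod d j)"
  show ?thesis
  proof (rule card_inj_on_le[where f = ?shift])
    show "inj_on ?shift {e \<in> box d. (\<Sum>i\<in>UNIV. e i) mod r = x mod r}"
    proof (rule inj_onI)
      fix e f assume e: "e \<in> {e \<in> box d. (\<Sum>i\<in>UNIV. e i) mod r = x mod r}"
        and f: "f \<in> {e \<in> box d. (\<Sum>i\<in>UNIV. e i) mod r = x mod r}" and eq: "?shift e = ?shift f"
      have "e i = f i" for i
      proof (cases "i = j")
        case True
        have "(e j + ?t) mod d j = (f j + ?t) mod d j" using fun_cong[OF eq, of j] by simp
        then have "int ((e j + ?t) mod d j) = int ((f j + ?t) mod d j)" by (rule arg_cong)
        \<comment> \<open>The translation cancels; both coordinates are below \<open>d j\<close>, so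
          congruence modulo \<open>d j\<close> is equality.\<close>
        then have "int (d j) dvd int (e j) - int (f j)"
          unfolding zmod_int mod_eq_dvd_iff by simp
        then have "int (e j mod d j) = int (f j mod d j)"
          unfolding zmod_int mod_eq_dvd_iff .
        then show ?thesis using True e f by (simp add: box_def)
      next
        case False
        then show ?thesis using fun_cong[OF eq, of i] by simp
      qed
      then show "e = f" by auto
    qed
    show "?shift ` {e \<in> box d. (\<Sum>i\<in>UNIV. e i) mod r = x mod r}
        \<subseteq> {e \<in> box d. (\<Sum>i\<in>UNIV. e i) mod r = y mod r}"
    proof safe
      fix e assume e: "e \<in> box d" and sum: "(\<Sum>i\<in>UNIV. e i) mod r = x mod r"
      show "?shift e \<in> box d" using e pos by (simp add: box_def)
      have split: "(\<Sum>i\<in>UNIV. f i) = f j + (\<Sum>i\<in>UNIV - {j}. f i)" for f :: "'n \<Rightarrow> nat"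
        by (simp add: sum.remove)
      have "(\<Sum>i\<in>UNIV. ?shift e i) = (e j + ?t) mod d j + (\<Sum>i\<in>UNIV - {j}. e i)"
        by (subst split) (auto intro: sum.cong)
      \<comment> \<open>Reduction modulo \<open>d j\<close> preserves the residue modulo
        \<open>r\<close> because \<open>r\<close> divides \<open>d j\<close>.\<close>
      also have "\<dots> mod r = ((e j + ?t) + (\<Sum>i\<in>UNIV - {j}. e i)) mod r"
        using mod_mod_cancel[OF dvd[of j], of "e j + ?t"] by (metis mod_add_left_eq)
      also have "(e j + ?t) + (\<Sum>i\<in>UNIV - {j}. e i) = (\<Sum>i\<in>UNIV. e i) + ?t"
        by (subst split[of e]) simp
      also have "((\<Sum>i\<in>UNIV. e i) + ?t) mod r = (x + ?t) mod r"
        using sum by (metis mod_add_left_eq)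
      also have "x + ?t = y + r * x"
        using \<open>0 < r\<close> by (cases r) auto
      also have "(y + r * x) mod r = y mod r" by simp
      finally show "(\<Sum>i\<in>UNIV. ?shift e i) mod r = y mod r" .
    qed
  qed (simp add: finite_box)
qed

text \<open>The \<open>r\<close> residue classes partition the box, and
  \<open>card_box_sum_mod_le\<close> in both directions makes them equally large.\<close>

lemma card_box_sum_mod:
  fixes d :: "'n :: finite \<Rightarrow> nat"
  assumes dvd: "\<And>i. r dvd d i" and pos: "\<And>i. 0 < d i" and "0 < r"
  shows "r * card {e \<in> box d. (\<Sum>i\<in>UNIV. e i) mod r = x mod r} = (\<Prod>i\<in>UNIV. d i)"
proof -
  let ?T = "\<lambda>y. {e \<in> box d. (\<Sum>i\<in>UNIV. e i) mod r = y mod r}"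
  have eq: "card (?T y) = card (?T x)" for y
    by (intro antisym card_box_sum_mod_le assms)
  have "box d = (\<Union>y<r. ?T y)"
    using \<open>0 < r\<close> by (auto intro!: bexI[of _ "_ mod r"])
  then have "(\<Prod>i\<in>UNIV. d i) = card (\<Union>y<r. ?T y)" by (simp flip: card_box)
  also have "\<dots> = (\<Sum>y<r. card (?T y))"
    by (rule card_UN_disjoint) (auto simp: finite_box)
  also have "\<dots> = (\<Sum>y<r. card (?T x))" by (intro sum.cong refl eq)
  finally show ?thesis by simp
qed

text \<open>In an \<open>exponent_grid\<close> these are the residues of the monomials of degree
  \<open>D\<close>, by \<open>residues_of_degree\<close>.\<close>

definition representable_box :: "('n :: finite \<Rightarrow> nat) \<Rightarrow> nat \<Rightarrow> ('n \<Rightarrow> nat) set" where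
  "representable_box d D = {e \<in> box d. \<exists>s\<in>semigroup_gen d. (\<Sum>i\<in>UNIV. e i) + s = D}"

text \<open>Division by \<open>r\<close> turns representability into membership in the semigroup of
  \<open>d'\<close>. If nonnegative, \<open>b\<close> is the last degree with a deficit;
  \<open>-1 \<le> b\<close> lets the regularity be written as \<open>b + 1\<close>.\<close>

lemma card_representable_box:
  fixes d d' :: "'n :: finite \<Rightarrow> nat"
  assumes d': "\<And>i. 0 < d' i" "(GCD i. d' i) = 1" and r: "0 < r" and d: "\<And>i. d i = r * d' i"
  defines "b \<equiv> int r * frobenius_number (semigroup_gen d') + (\<Sum>i\<in>UNIV. int (d i) - 1)"
  shows "-1 \<le> b"
    and "b < int D \<Longrightarrow> card (representable_box d D) = (\<Prod>i\<in>UNIV. d i) div r"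
    and "b = int D \<Longrightarrow> card (representable_box d D) < (\<Prod>i\<in>UNIV. d i) div r"
proof -
  let ?S = "semigroup_gen d'"
  let ?g = "frobenius_number ?S"
  let ?T = "{e \<in> box d. (\<Sum>i\<in>UNIV. e i) mod r = D mod r}"
  obtain N where "\<forall>m\<ge>N. m \<in> ?S" using semigroup_gen_contains_large[OF d'] by blast
  note g = frobenius_number_props[OF this]
  have d_pos: "0 < d i" for i using d' r d by simp
  have S: "semigroup_gen d = (*) r ` ?S"
    using semigroup_gen_scale[of r d'] d by (metis ext)
  have "r * card ?T = (\<Prod>i\<in>UNIV. d i)"
    by (rule card_box_sum_mod) (use d d_pos r in auto)
  then have "(\<Prod>i\<in>UNIV. d i) div r = (r * card ?T) div r" by (rule arg_cong[OF sym])
  then have card_T: "card ?T = (\<Prod>i\<in>UNIV. d i) div r" using r by simp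
  have fin: "finite ?T" by (simp add: finite_box)
  have sub: "representable_box d D \<subseteq> ?T"
    by (auto simp: representable_box_def S)
  have sum_le: "int (\<Sum>i\<in>UNIV. e i) \<le> (\<Sum>i\<in>UNIV. int (d i) - 1)" if "e \<in> box d" for e
    unfolding of_nat_sum using that by (intro sum_mono) (auto simp: box_def less_eq_Suc_le)
  \<comment> \<open>The extreme case is Frobenius number \<open>-1\<close>, contributing
    \<open>-r\<close>; a single coordinate already gives \<open>d j - 1 \<ge> r - 1\<close>.\<close>
  show "-1 \<le> b"
  proof -
    fix j :: 'n
    have "r \<le> d j" using d[of j] d'(1)[of j] by simp
    then have "int r - 1 \<le> int (d j) - 1" by simp
    also have "\<dots> \<le> (\<Sum>i\<in>UNIV. int (d i) - 1)"
      using d_pos by (intro member_le_sum) (auto simp: Suc_le_eq)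
    finally have "int r - 1 \<le> (\<Sum>i\<in>UNIV. int (d i) - 1)" .
    moreover have "int r * (-1) \<le> int r * ?g" using g(3) by (intro mult_left_mono) auto
    ultimately show ?thesis unfolding b_def by linarith
  qed
  show "card (representable_box d D) = (\<Prod>i\<in>UNIV. d i) div r" if D: "b < int D"
  proof -
    have "?T \<subseteq> representable_box d D"
    proof
      fix e assume e: "e \<in> ?T"
      define s where "s = (\<Sum>i\<in>UNIV. e i)"
      have "D mod r = s mod r" using e by (simp add: s_def)
      then have "int (D mod r) = int (s mod r)" by (rule arg_cong)
      then have "int r dvd int D - int s" unfolding zmod_int mod_eq_dvd_iff .
      then obtain k where k: "int D - int s = int r * k" by (elim dvdE)
      have "int s \<le> (\<Sum>i\<in>UNIV. int (d i) - 1)" using sum_le[of e] e unfolding s_def by blast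
      \<comment> \<open>\<open>D\<close> exceeds \<open>b\<close> and \<open>s\<close> is at most
        the sum of the \<open>d i - 1\<close>, so their difference exceeds
        \<open>r * ?g\<close>.\<close>
      then have "int r * ?g < int r * k"
        using D k unfolding b_def by linarith
      then have "?g < k" using r by simp
      then have "k \<in> int ` ?S" by (rule g(2))
      then obtain l where l: "l \<in> ?S" "k = int l" by auto
      then have "int (s + r * l) = int D" using k by simp
      then have "s + r * l = D" by (simp only: of_nat_eq_iff)
      then show "e \<in> representable_box d D" using e l(1) by (auto simp: representable_box_def S s_def)
    qed
    then have "representable_box d D = ?T" by (rule subset_antisym[OF sub])
    then show ?thesis by (simp only: card_T)
  qed
  show "card (representable_box d D) < (\<Prod>i\<in>UNIV. d i) div r" if D: "b = int D"
  proof -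
    \<comment> \<open>The corner has the largest coordinate sum in the box. For \<open>D = b\<close>
      it leaves exactly \<open>r * ?g\<close> to be represented, and \<open>?g\<close> is not in the
      semigroup.\<close>
    let ?e = "\<lambda>i. d i - 1"
    have e: "?e \<in> box d" using d_pos by (simp add: box_def)
    have sum_e: "int (\<Sum>i\<in>UNIV. ?e i) = (\<Sum>i\<in>UNIV. int (d i) - 1)"
      unfolding of_nat_sum using d_pos by (intro sum.cong) (auto simp: of_nat_diff Suc_le_eq)
    define s where "s = (\<Sum>i\<in>UNIV. ?e i)"
    have D': "int D - int s = int r * ?g"
      using D sum_e unfolding b_def s_def by linarith
    then have "int (D mod r) = int (s mod r)" unfolding zmod_int mod_eq_dvd_iff by simp
    then have "?e \<in> ?T" using e by (simp add: s_def)
    moreover have "?e \<notin> representable_box d D"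
    proof
      assume "?e \<in> representable_box d D"
      then obtain l where l: "l \<in> ?S" "s + r * l = D"
        by (auto simp: representable_box_def S s_def)
      then have "int s + int r * int l = int D" by (metis of_nat_add of_nat_mult)
      then have "int r * ?g = int r * int l" using D' by linarith
      then have "?g = int l" using r by simp
      then show False using g(1) l(1) by blast
    qed
    ultimately have "representable_box d D \<subset> ?T" using sub by blast
    then show ?thesis using psubset_card_mono[OF fin] card_T by simp
  qed
qed

section \<open>Degree and regularity of degenerate tori\<close>

lemma of_nat_card_field: "of_nat CARD('a :: {field, finite}) = (0 :: 'a)"
proof -
  \<comment> \<open>Translation by 1 permutes the field, so the added ones sum to 0.\<close>
  have "(\<Sum>x\<in>UNIV. x + 1 :: 'a) = (\<Sum>x\<in>UNIV. x)"
    by (rule sum.reindex_bij_witness[of _ "\<lambda>x. x - 1" "\<lambda>x. x + 1"]) auto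
  then show ?thesis by (simp add: sum.distrib)
qed

lemma
  shows group_mult_of_class_ring: "group (mult_of (class_ring :: 'a :: field ring))"
    and pow_mult_of_class_ring: "x [^]\<^bsub>mult_of (class_ring :: 'a ring)\<^esub> (k :: nat) = x ^ k"
    and carrier_mult_of_class_ring: "carrier (mult_of (class_ring :: 'a ring)) = UNIV - {0}"
    and one_mult_of_class_ring: "\<one>\<^bsub>mult_of (class_ring :: 'a ring)\<^esub> = 1"
  using field.field_mult_group[OF class_field]
  by (auto simp: nat_pow_mult_of class_ring_simps)

lemma
  fixes x :: "'a :: {field, finite}"
  assumes "x \<noteq> 0"
  shows ord_class_ring_pos: "0 < group.ord (mult_of class_ring) x"
    and power_eq_1_iff_ord_dvd: "x ^ k = 1 \<longleftrightarrow> group.ord (mult_of class_ring) x dvd k"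
    and ord_class_ring_power: "r dvd group.ord (mult_of class_ring) x \<Longrightarrow> r \<noteq> 0 \<Longrightarrow>
      group.ord (mult_of class_ring) (x ^ r) = group.ord (mult_of class_ring) x div r"
    and of_nat_ord_class_ring: "of_nat (group.ord (mult_of class_ring) x) \<noteq> (0 :: 'a)"
proof -
  let ?G = "mult_of (class_ring :: 'a ring)"
  interpret G: group ?G by (rule group_mult_of_class_ring)
  have x: "x \<in> carrier ?G" and fin: "finite (carrier ?G)"
    using assms by (auto simp: carrier_mult_of_class_ring)
  show "0 < G.ord x" using G.ord_ge_1[OF fin x] by simp
  show "x ^ k = 1 \<longleftrightarrow> G.ord x dvd k"
    using G.pow_eq_id[OF x] by (simp only: pow_mult_of_class_ring one_mult_of_class_ring)
  show "G.ord (x ^ r) = G.ord x div r" if "r dvd G.ord x" "r \<noteq> 0"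
    using G.ord_pow[OF x that] by (simp only: pow_mult_of_class_ring)
  have "G.ord x dvd card (UNIV - {0 :: 'a})"
    using G.ord_dvd_group_order[OF x] by (simp only: Coset.order_def carrier_mult_of_class_ring)
  then have "G.ord x dvd CARD('a) - 1" by (simp add: card_Diff_singleton)
  then obtain k where "CARD('a) - 1 = G.ord x * k" by (elim dvdE)
  \<comment> \<open>\<open>CARD('a)\<close> is 0 in the field, so an order vanishing there would
    give \<open>1 = 0\<close>.\<close>
  then have "CARD('a) = G.ord x * k + 1"
    using zero_less_card_finite[where 'a = 'a] by linarith
  then have "of_nat (G.ord x * k + 1) = (0 :: 'a)" using of_nat_card_field[where 'a = 'a] by metis
  then show "of_nat (G.ord x) \<noteq> (0 :: 'a)" by auto
qed

lemma generator_powers: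
  fixes \<beta> x :: "'a :: {field, finite}"
  assumes "\<beta> \<in> carrier (mult_of class_ring)"
    and "generate (mult_of class_ring) {\<beta>} = carrier (mult_of class_ring)" and "x \<noteq> 0"
  shows "\<exists>k. x = \<beta> ^ k"
proof -
  interpret G: group "mult_of (class_ring :: 'a ring)" by (rule group_mult_of_class_ring)
  have "\<beta> \<noteq> 0" using assms(1) by (simp add: carrier_mult_of_class_ring)
  then have "generate (mult_of class_ring) {\<beta>} = {\<beta> ^ k | k. k \<in> (UNIV :: nat set)}"
    using G.generate_pow_nat[OF assms(1)] ord_class_ring_pos[of \<beta>]
    by (simp only: pow_mult_of_class_ring) simp
  then show ?thesis using assms(2,3) by (auto simp: carrier_mult_of_class_ring)
qed

section \<open>Vanishing ideals and points of the torus\<close>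

lemma vanishing_ideal_ideal: "ideal (vanishing_ideal X) (poly_alg :: ('a :: field, ('n :: finite, 'a) mpoly) module)"
  unfolding vanishing_ideal_def by (rule poly_alg.genideal_ideal) simp

lemma vanishing_idealI:
  assumes "homogeneous f" "\<And>P x. P \<in> X \<Longrightarrow> x \<in> P \<Longrightarrow> eval_mpoly f x = 0"
  shows "f \<in> vanishing_ideal X"
  unfolding vanishing_ideal_def using assms by (intro subsetD[OF poly_alg.genideal_self]) auto

text \<open>Members of the generated ideal need not be homogeneous, but the polynomials vanishing at
  the fixed vector \<open>x\<close> form an ideal containing all generators.\<close>

lemma vanishing_idealD:
  fixes f :: "('n :: finite, 'a :: field) mpoly"
  assumes "f \<in> vanishing_ideal X" "P \<in> X" "x \<in> P"
  shows "eval_mpoly f x = 0"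
proof -
  let ?Z = "{f :: ('n, 'a) mpoly. eval_mpoly f x = 0}"
  have "ideal ?Z poly_alg"
  proof (rule idealI)
    show "ring (poly_alg :: ('a, ('n, 'a) mpoly) module)" by (rule poly_alg.ring_axioms)
    show "subgroup ?Z (add_monoid poly_alg)"
    proof (rule group.subgroupI)
      show "group (add_monoid (poly_alg :: ('a, ('n, 'a) mpoly) module))" by (rule poly_alg.add.group_axioms)
      fix p :: "('n, 'a) mpoly" assume p: "p \<in> ?Z"
      have "\<ominus>\<^bsub>poly_alg\<^esub> p = - p" using poly_alg.minus_equality[of "- p" p] by simp
      then show "inv\<^bsub>add_monoid poly_alg\<^esub> p \<in> ?Z"
        using p by (simp add: a_inv_def eval_mpoly_uminus)
    qed (auto simp: eval_mpoly_add intro: exI[of _ 0])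
  qed (auto simp: eval_mpoly_mult)
  then have "vanishing_ideal X \<subseteq> ?Z"
    unfolding vanishing_ideal_def by (rule poly_alg.genideal_minimal) (use assms in auto)
  then show ?thesis using assms by auto
qed

lemma degenerate_torus_pointE:
  assumes "P \<in> degenerate_torus v" "y \<in> P"
  obtains c x where "c \<noteq> 0" "\<forall>i. x i \<noteq> 0" "y = (\<lambda>i. c * x i ^ v i)"
  using assms by (auto simp: degenerate_torus_def proj_point_def proj_rel_def)

lemma degenerate_torus_pointI:
  fixes x :: "'n \<Rightarrow> 'a :: field"
  assumes "\<And>i. x i \<noteq> 0"
  shows "\<exists>P\<in>degenerate_torus v. (\<lambda>i. x i ^ v i) \<in> P"
proof -
  have "(\<lambda>i. x i ^ v i) \<noteq> (\<lambda>_. 0)" using assms by (auto simp: fun_eq_iff)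
  then have "(\<lambda>i. x i ^ v i) \<in> proj_point (\<lambda>i. x i ^ v i)"
    by (auto simp: proj_point_def proj_rel_def intro: exI[of _ 1])
  then show ?thesis using assms by (auto simp: degenerate_torus_def)
qed

lemma krull_dim_degenerate_torus:
  fixes v :: "'n :: finite \<Rightarrow> nat"
  shows "krull_dim (poly_alg Quot (vanishing_ideal (degenerate_torus v) :: ('n, 'a :: {field, finite}) mpoly set)) \<le> 1"
proof (rule krull_dim_quot_le_1)
  fix i j :: 'n
  let ?f = "\<Prod>c\<in>UNIV - {0}. mvar i - Poly_Mapping.single 0 c * mvar j :: ('n, 'a) mpoly"
  have eval: "eval_mpoly (mvar i - Poly_Mapping.single 0 c * mvar j) y = y i - c * y j"
    for c :: 'a and y
    using eval_mpoly_add[of "mvar i" "- (Poly_Mapping.single 0 c * mvar j)" y]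
    by (simp add: eval_mpoly_uminus eval_mpoly_mult eval_mpoly_single)
  have linear: "mvar i - Poly_Mapping.single 0 c * mvar j \<in> homog_part 1" for c :: 'a
    using homog_part_add[OF mvar_homog_part homog_part_uminus[OF homog_part_scale[OF mvar_homog_part]]]
    by (metis diff_conv_add_uminus)
  have "homogeneous ?f" by (rule exI, rule homog_part_prod, rule linear)
  then show "?f \<in> vanishing_ideal (degenerate_torus v)"
  proof (rule vanishing_idealI)
    fix P and y :: "'n \<Rightarrow> 'a" assume "P \<in> degenerate_torus v" "y \<in> P"
    then obtain c x where "c \<noteq> 0" "\<forall>i. x i \<noteq> 0" "y = (\<lambda>i. c * x i ^ v i)"
      by (rule degenerate_torus_pointE)
    then have y: "y i \<noteq> 0" for i by simp
    \<comment> \<open>With no zero coordinates, \<open>y i / y j\<close> is one of the scalars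
      \<open>c\<close> in the product and annihilates its factor.\<close>
    then have "\<exists>c\<in>UNIV - {0}. y i - c * y j = 0" by (intro bexI[of _ "y i / y j"]) auto
    then show "eval_mpoly ?f y = 0"
      unfolding eval_mpoly_prod eval by (intro prod_zero) auto
  qed
qed (rule vanishing_ideal_ideal)

text \<open>The definite description is resolved by uniqueness: polynomials that agree at infinitely
  many naturals coincide.\<close>

lemma hilbert_poly_eventually_const:
  assumes "\<And>D. D0 \<le> D \<Longrightarrow> hilbert_fun I D = N"
  shows "hilbert_poly I = [:of_nat N:]"
  unfolding hilbert_poly_def
proof (rule the_equality)
  show "eventually (\<lambda>D. poly [:of_nat N:] (of_nat D :: rat) = of_nat (hilbert_fun I D)) sequentially"
    using assms by (auto simp: eventually_sequentially)
next
  fix h :: "rat poly"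
  assume "eventually (\<lambda>D. poly h (of_nat D) = of_nat (hilbert_fun I D)) sequentially"
  then obtain D1 where D1: "\<And>D. D1 \<le> D \<Longrightarrow> poly h (of_nat D) = of_nat (hilbert_fun I D)"
    by (auto simp: eventually_sequentially)
  show "h = [:of_nat N:]"
  proof (rule ccontr)
    assume "h \<noteq> [:of_nat N:]"
    then have "finite {x. poly (h - [:of_nat N:]) x = 0}" by (intro poly_roots_finite) simp
    moreover have "of_nat ` {max D0 D1..} \<subseteq> {x. poly (h - [:of_nat N:]) x = 0}"
      using D1 assms by auto
    ultimately have "finite ((of_nat :: nat \<Rightarrow> rat) ` {max D0 D1..})" by (rule finite_subset[rotated])
    then show False by (simp add: finite_image_iff inj_on_def infinite_Ici)
  qed
qed

theorem corollary3p13: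
  fixes v d d' :: "'n :: finite \<Rightarrow> nat" and \<beta> :: "'a :: {field, finite}" and r :: nat
    and I :: "('n, 'a) mpoly set"
  assumes v_pos: "\<And>i. 0 < v i"
    and I_eq: "I = vanishing_ideal (degenerate_torus v)"
    and \<beta>_carrier: "\<beta> \<in> carrier (mult_of class_ring)"
    and \<beta>_gen: "generate (mult_of class_ring) {\<beta>} = carrier (mult_of class_ring)"
    and d_eq: "\<And>i. d i = group.ord (mult_of class_ring) (\<beta> ^ v i)"
    and r_eq: "r = (GCD i. d i)"
    and d'_eq: "\<And>i. d' i = group.ord (mult_of class_ring) (\<beta> ^ (r * v i))"
  shows "((\<forall>i. 0 < d' i) \<and> (GCD i. d' i) = 1)
    \<and> deg_quot I = of_nat (\<Prod>i\<in>UNIV. d i) / of_nat (GCD i. d i)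
    \<and> (complete_intersection poly_alg I \<longrightarrow>
         int (reg_quot I) =
           int (GCD i. d i) * frobenius_number (semigroup_gen d')
             + (\<Sum>i\<in>UNIV. int (d i)) - (int CARD('n) - 1))"
proof -
  have \<beta>: "\<beta> \<noteq> 0" using \<beta>_carrier by (simp add: carrier_mult_of_class_ring)
  define \<gamma> where "\<gamma> i = \<beta> ^ v i" for i
  have \<gamma>: "\<gamma> i \<noteq> 0" for i using \<beta> by (simp add: \<gamma>_def)
  have d: "d i = group.ord (mult_of class_ring) (\<gamma> i)" for i by (simp add: d_eq \<gamma>_def)
  have d_pos: "0 < d i" for i using ord_class_ring_pos[OF \<gamma>] by (simp add: d)
  interpret exponent_grid \<gamma> d
  proof
    fix i k
    show "0 < d i" by (rule d_pos)
    show "\<gamma> i ^ d i = 1" using power_eq_1_iff_ord_dvd[OF \<gamma>] by (simp add: d)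
    show "\<gamma> i ^ k \<noteq> 1" if "0 < k" "k < d i"
      using power_eq_1_iff_ord_dvd[OF \<gamma>, of i k] nat_dvd_not_less[OF that] by (simp add: d)
    show "of_nat (d i) \<noteq> (0 :: 'a)" using of_nat_ord_class_ring[OF \<gamma>] by (simp add: d)
  qed

  have r_dvd: "r dvd d i" for i unfolding r_eq by (rule Gcd_dvd) simp
  then have r_pos: "0 < r" using d_pos by (metis dvd_0_left_iff neq0_conv)
  \<comment> \<open>\<open>\<beta> ^ (r * v i)\<close> is the \<open>r\<close>-th power of
    \<open>\<gamma> i\<close>, whose order \<open>d i\<close> is divisible by
    \<open>r\<close>.\<close>
  have d': "d' i = d i div r" for i
    using ord_class_ring_power[OF \<gamma>, of r i] r_dvd r_pos
    by (simp add: d'_eq d \<gamma>_def mult.commute flip: power_mult)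
  have d_r: "d i = r * d' i" for i using r_dvd by (simp add: d')
  have d'_pos: "0 < d' i" for i using d_pos[of i] d_r[of i] by (metis neq0_conv mult_0_right)
  \<comment> \<open>Pulling the factor \<open>r\<close> out of the gcd of the \<open>d i\<close>
    leaves gcd 1 for the \<open>d' i\<close>.\<close>
  have range_d: "range d = (*) r ` range d'" using d_r by (auto simp: image_iff)
  have "r = Gcd ((*) r ` range d')" using r_eq by (subst range_d [symmetric])
  also have "\<dots> = r * (GCD i. d' i)" by (simp add: Gcd_mult)
  finally have "r = r * (GCD i. d' i)" .
  then have gcd_d': "(GCD i. d' i) = 1" using r_pos by simp

  have grid: "grid_point k = (\<lambda>i. (\<beta> ^ k i) ^ v i)" for k
    by (simp add: grid_point_def \<gamma>_def fun_eq_iff mult.commute flip: power_mult)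
  \<comment> \<open>Every representative of a torus point is a scalar multiple of a grid point, as
    \<open>\<beta>\<close> generates the units; scaling by a unit does not affect the vanishing of a
    form.\<close>
  have I_part: "I \<inter> homog_part D = {p \<in> homog_part D. \<forall>k. eval_mpoly p (grid_point k) = 0}" for D
  proof (intro equalityI subsetI)
    fix p assume p: "p \<in> I \<inter> homog_part D"
    have "eval_mpoly p (grid_point k) = 0" for k
    proof -
      obtain P where "P \<in> degenerate_torus v" "(\<lambda>i. (\<beta> ^ k i) ^ v i) \<in> P"
        using degenerate_torus_pointI[of "\<lambda>i. \<beta> ^ k i" v] \<beta> by auto
      then show ?thesis using vanishing_idealD[of p] p by (auto simp: I_eq grid)
    qed
    then show "p \<in> {p \<in> homog_part D. \<forall>k. eval_mpoly p (grid_point k) = 0}" using p by simp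
  next
    fix p assume p: "p \<in> {p \<in> homog_part D. \<forall>k. eval_mpoly p (grid_point k) = 0}"
    have "eval_mpoly p y = 0" if "P \<in> degenerate_torus v" "y \<in> P" for P y
    proof -
      obtain c x where cx: "c \<noteq> 0" "\<forall>i. x i \<noteq> 0" "y = (\<lambda>i. c * x i ^ v i)"
        using \<open>P \<in> degenerate_torus v\<close> \<open>y \<in> P\<close> by (rule degenerate_torus_pointE)
      have "\<forall>i. \<exists>k. x i = \<beta> ^ k"
        using generator_powers[OF \<beta>_carrier \<beta>_gen] cx(2) by blast
      then obtain k where "\<And>i. x i = \<beta> ^ k i" by metis
      then have "y = (\<lambda>i. c * grid_point k i)" using cx(3) by (simp add: grid)
      then show ?thesis using p eval_mpoly_homog_scale[of p D c "grid_point k"] by simp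
    qed
    then have "p \<in> I" unfolding I_eq using p by (intro vanishing_idealI) auto
    then show "p \<in> I \<inter> homog_part D" using p by simp
  qed
  define N where "N = (\<Prod>i\<in>UNIV. d i) div r"
  define b where "b = int r * frobenius_number (semigroup_gen d') + (\<Sum>i\<in>UNIV. int (d i) - 1)"
  have H: "hilbert_fun I D = card (representable_box d D)" for D
    using hilbert_fun_eq_card_residues[OF I_part]
    by (simp add: residues_of_degree representable_box_def box_def)
  note count = card_representable_box[OF d'_pos gcd_d' r_pos d_r, folded b_def N_def H]
  have hp: "hilbert_poly I = [:of_nat N:]"
    by (rule hilbert_poly_eventually_const[of "nat (b + 1)"]) (rule count(2), linarith)

  have "r dvd (\<Prod>i\<in>UNIV. d i)" using dvd_trans[OF r_dvd dvd_prodI[of UNIV _ d]] by auto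
  then have "(\<Prod>i\<in>UNIV. d i) = N * r" by (simp add: N_def)
  then have N: "(of_nat N :: rat) = of_nat (\<Prod>i\<in>UNIV. d i) / of_nat r"
    using r_pos by simp
  \<comment> \<open>An upper bound suffices: by truncated subtraction, dimensions 0 and 1 both make
    \<open>deg_quot\<close> read off the constant coefficient with factorial 1.\<close>
  have "the_enat (krull_dim (poly_alg Quot I)) \<le> 1"
    using krull_dim_degenerate_torus[of v, where 'a = 'a] unfolding I_eq
    by (cases "krull_dim (poly_alg Quot (vanishing_ideal (degenerate_torus v) :: ('n, 'a) mpoly set))")
      (auto simp: one_enat_def)
  then have deg: "deg_quot I = of_nat N" by (simp add: deg_quot_def hp)

  have "reg_quot I = nat (b + 1)"
    unfolding reg_quot_def hp
  proof (rule Least_equality)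
    show "\<forall>D\<ge>nat (b + 1). poly [:of_nat N:] (of_nat D) = (of_nat (hilbert_fun I D) :: rat)"
      using count(2) by (auto simp: nat_le_iff)
  next
    fix l assume l: "\<forall>D\<ge>l. poly [:of_nat N:] (of_nat D) = (of_nat (hilbert_fun I D) :: rat)"
    show "nat (b + 1) \<le> l"
    proof (rule ccontr)
      assume "\<not> nat (b + 1) \<le> l"
      \<comment> \<open>The assumed failure makes \<open>b\<close> nonnegative, hence an actual
        degree, and there the Hilbert function is less than \<open>N\<close>.\<close>
      then have "b = int (nat b)" "l \<le> nat b" by auto
      then show False using l count(3)[of "nat b"] by fastforce
    qed
  qed
  then have "int (reg_quot I) = b + 1" using count(1) by simp
  \<comment> \<open>Each of the \<open>CARD('n)\<close> summands in \<open>b\<close> carries a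
    \<open>-1\<close>, and the added 1 cancels one of them.\<close>
  also have "\<dots> = int r * frobenius_number (semigroup_gen d') + (\<Sum>i\<in>UNIV. int (d i)) - (int CARD('n) - 1)"
    by (simp add: b_def sum_subtractf)
  finally show ?thesis using d'_pos gcd_d' deg N by (simp add: r_eq)
qed

end
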